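(* Let $V$ be a nontrivial finite-dimensional irreducible $\boxtimes$-module over $\mathbb F$. Then the following (i), (ii) are equivalent. (i) $V$ is isomorphic to an evaluation module for $\boxtimes$. (ii) $V$ has shape $(1,1,\ldots,1)$.
   Context: $\mathbb F$ is an algebraically closed field of characteristic $0$, and $\mathbb I=\{0,1,2,3\}$. The tetrahedron algebra $\boxtimes$ is the Lie algebra over $\mathbb F$ with generators $\{x_{ij}\mid i,j\in\mathbb I,\ i\ne j\}$ and relations: (i) $x_{ij}+x_{ji}=0$ for distinct $i,j$; (ii) $[x_{ij},x_{jk}]=2x_{ij}+2x_{jk}$ for mutually distinct $i,j,k$; (iii) $[x_{ij},[x_{ij},[x_{ij},x_{k\ell}]]]=4[x_{ij},x_{k\ell}]$ for mutually distinct $i,j,k,\ell$. The trivial $\boxtimes$-module is the one-dimensional module on which every element of $\boxtimes$ acts as $0$ (unique up to isomorphism); other irreducible modules are nontrivial. Shape: for a finite-dimensional irreducible $\boxtimes$-module $V$ it is known (Hartwig) that every $x_{ij}$ acts semisimply on $V$ and that there is an integer $d\ge0$ (the diameter of $V$) such that for all distinct $i,j$ the set of distinct eigenvalues of $x_{ij}$ on $V$ is $\{d-2n\mid 0\le n\le d\}$; moreover for $0\le n\le d$ the dimension $\rho_n$ of the eigenspace of $x_{ij}$ for eigenvalue $2n-d$ does not depend on $i,j$. The shape of $V$ is the sequence $\{\rho_n\}_{n=0}^d$. Let $\mathfrak{sl}_2=\mathfrak{sl}_2(\mathbb F)$ with basis $e,f,h$, $[h,e]=2e$, $[h,f]=-2f$,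 $[e,f]=h$. Put $x=2e-h$, $y=-2f-h$, $z=h$. For $a\in\mathbb F\setminus\{0,1\}$ let $EV_a:\boxtimes\to\mathfrak{sl}_2$ be the (surjective) Lie algebra homomorphism with $x_{12}\mapsto x$, $x_{23}\mapsto y$, $x_{31}\mapsto z$, $x_{03}\mapsto ay+(a-1)z$, $x_{01}\mapsto(1-a^{-1})z-a^{-1}x$, $x_{02}\mapsto(1-a)^{-1}x+a(1-a)^{-1}y$. For $d\ge0$ let $V_d$ be the irreducible $\mathfrak{sl}_2$-module of dimension $d+1$. An evaluation module is a $\boxtimes$-module $V_d(a)$, with $d\ge 1$ an integer and $a\in\mathbb F\setminus\{0,1\}$, obtained from $V_d$ by pulling back the action via $EV_a$. *)

theory Defs
  imports "HOL-Analysis.Analysis"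
begin

section \<open>Lie algebras, homomorphisms and modules\<close>

locale lie_algebra = vector_space scale
  for scale :: "'a::field \<Rightarrow> 'l::ab_group_add \<Rightarrow> 'l" +
  fixes bracket :: "'l \<Rightarrow> 'l \<Rightarrow> 'l"
  assumes bracket_add_left: "bracket (x + y) z = bracket x z + bracket y z"
    and bracket_add_right: "bracket x (y + z) = bracket x y + bracket x z"
    and bracket_scale_left: "bracket (scale c x) y = scale c (bracket x y)"
    and bracket_scale_right: "bracket x (scale c y) = scale c (bracket x y)"
    and bracket_self: "bracket x x = 0"
    and jacobi: "bracket x (bracket y z) + bracket y (bracket z x) + bracket z (bracket x y) = 0"

definition lie_hom ::
  "('a::field \<Rightarrow> 'l::ab_group_add \<Rightarrow> 'l) \<Rightarrow> ('l \<Rightarrow> 'l \<Rightarrow> 'l) \<Rightarrow>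
   ('a \<Rightarrow> 'm::ab_group_add \<Rightarrow> 'm) \<Rightarrow> ('m \<Rightarrow> 'm \<Rightarrow> 'm) \<Rightarrow> ('l \<Rightarrow> 'm) \<Rightarrow> bool"
  where "lie_hom sc br sc' br' \<phi> \<longleftrightarrow>
    Vector_Spaces.linear sc sc' \<phi> \<and> (\<forall>u v. \<phi> (br u v) = br' (\<phi> u) (\<phi> v))"

text \<open>The underlying space of a module is a subspace \<open>V\<close> of an ambient vector space; the values of
  the action outside \<open>V\<close> are irrelevant.\<close>

locale lie_module = L: lie_algebra lscale bracket + V: vector_space scale
  for lscale :: "'a::field \<Rightarrow> 'l::ab_group_add \<Rightarrow> 'l"
    and bracket :: "'l \<Rightarrow> 'l \<Rightarrow> 'l"
    and scale :: "'a \<Rightarrow> 'v::ab_group_add \<Rightarrow> 'v" +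
  fixes V :: "'v set" and act :: "'l \<Rightarrow> 'v \<Rightarrow> 'v"
  assumes subspace: "V.subspace V"
    and act_closed: "v \<in> V \<Longrightarrow> act x v \<in> V"
    and act_add_right: "v \<in> V \<Longrightarrow> w \<in> V \<Longrightarrow> act x (v + w) = act x v + act x w"
    and act_scale_right: "v \<in> V \<Longrightarrow> act x (scale c v) = scale c (act x v)"
    and act_add_left: "v \<in> V \<Longrightarrow> act (x + y) v = act x v + act y v"
    and act_scale_left: "v \<in> V \<Longrightarrow> act (lscale c x) v = scale c (act x v)"
    and act_bracket: "v \<in> V \<Longrightarrow> act (bracket x y) v = act x (act y v) - act y (act x v)"

definition finite_dim :: "('a::field \<Rightarrow> 'v::ab_group_add \<Rightarrow> 'v) \<Rightarrow> 'v set \<Rightarrow> bool"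
  where "finite_dim sc V \<longleftrightarrow> (\<exists>B. finite B \<and> V \<subseteq> module.span sc B)"

definition irreducible_action ::
  "('a::field \<Rightarrow> 'v::ab_group_add \<Rightarrow> 'v) \<Rightarrow> 'v set \<Rightarrow> ('l \<Rightarrow> 'v \<Rightarrow> 'v) \<Rightarrow> bool"
  where "irreducible_action sc V act \<longleftrightarrow> V \<noteq> {0} \<and>
    (\<forall>W. module.subspace sc W \<and> W \<subseteq> V \<and> (\<forall>x. \<forall>w\<in>W. act x w \<in> W) \<longrightarrow> W = {0} \<or> W = V)"

definition trivial_action ::
  "('a::field \<Rightarrow> 'v::ab_group_add \<Rightarrow> 'v) \<Rightarrow> 'v set \<Rightarrow> ('l \<Rightarrow> 'v \<Rightarrow> 'v) \<Rightarrow> bool"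
  where "trivial_action sc V act \<longleftrightarrow>
    vector_space.dim sc V = 1 \<and> (\<forall>x. \<forall>v\<in>V. act x v = 0)"

definition module_iso ::
  "('a::field \<Rightarrow> 'v::ab_group_add \<Rightarrow> 'v) \<Rightarrow> 'v set \<Rightarrow> ('l \<Rightarrow> 'v \<Rightarrow> 'v) \<Rightarrow>
   ('a \<Rightarrow> 'w::ab_group_add \<Rightarrow> 'w) \<Rightarrow> 'w set \<Rightarrow> ('l \<Rightarrow> 'w \<Rightarrow> 'w) \<Rightarrow> bool"
  where "module_iso sc V act sc' W act' \<longleftrightarrow>
    (\<exists>T. bij_betw T V W \<and>
      (\<forall>u\<in>V. \<forall>v\<in>V. T (u + v) = T u + T v) \<and>
      (\<forall>c. \<forall>v\<in>V. T (sc c v) = sc' c (T v)) \<and>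
      (\<forall>x. \<forall>v\<in>V. T (act x v) = act' x (T v)))"

section \<open>The tetrahedron algebra\<close>

text \<open>The algebra is the set of formal Lie expressions in the generators modulo the least congruence
  containing the Lie algebra axioms and the defining relations. Generators \<open>TGen i j\<close> exist for all
  \<open>i\<close>, \<open>j\<close>; the superfluous ones with \<open>i = j\<close> are set to zero (rule \<open>gen_diag\<close>), which leaves the
  presented algebra unchanged. The index set is the type \<open>4\<close>, in which \<open>4 = 0\<close>.\<close>

datatype 'a tterm =
    TGen 4 4
  | TZero
  | TAdd "'a tterm" "'a tterm"
  | TNeg "'a tterm"
  | TScale 'a "'a tterm"
  | TBr "'a tterm" "'a tterm"

inductive tcong :: "'a::field tterm \<Rightarrow> 'a tterm \<Rightarrow> bool" where
  refl: "tcong s s"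
| sym: "tcong s t \<Longrightarrow> tcong t s"
| trans: "tcong s t \<Longrightarrow> tcong t u \<Longrightarrow> tcong s u"
| cong_add: "tcong s s' \<Longrightarrow> tcong t t' \<Longrightarrow> tcong (TAdd s t) (TAdd s' t')"
| cong_neg: "tcong s s' \<Longrightarrow> tcong (TNeg s) (TNeg s')"
| cong_scale: "tcong s s' \<Longrightarrow> tcong (TScale c s) (TScale c s')"
| cong_br: "tcong s s' \<Longrightarrow> tcong t t' \<Longrightarrow> tcong (TBr s t) (TBr s' t')"
| add_assoc: "tcong (TAdd (TAdd s t) u) (TAdd s (TAdd t u))"
| add_comm: "tcong (TAdd s t) (TAdd t s)"
| add_zero: "tcong (TAdd TZero s) s"
| add_neg: "tcong (TAdd (TNeg s) s) TZero"
| scale_add_right: "tcong (TScale c (TAdd s t)) (TAdd (TScale c s) (TScale c t))"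
| scale_add_left: "tcong (TScale (b + c) s) (TAdd (TScale b s) (TScale c s))"
| scale_scale: "tcong (TScale b (TScale c s)) (TScale (b * c) s)"
| scale_one: "tcong (TScale 1 s) s"
| br_add_left: "tcong (TBr (TAdd s t) u) (TAdd (TBr s u) (TBr t u))"
| br_add_right: "tcong (TBr s (TAdd t u)) (TAdd (TBr s t) (TBr s u))"
| br_scale_left: "tcong (TBr (TScale c s) t) (TScale c (TBr s t))"
| br_scale_right: "tcong (TBr s (TScale c t)) (TScale c (TBr s t))"
| br_self: "tcong (TBr s s) TZero"
| jacobi: "tcong (TAdd (TAdd (TBr s (TBr t u)) (TBr t (TBr u s))) (TBr u (TBr s t))) TZero"
| gen_diag: "tcong (TGen i i) TZero"
| rel_i: "i \<noteq> j \<Longrightarrow> tcong (TAdd (TGen i j) (TGen j i)) TZero"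
| rel_ii: "distinct [i, j, k] \<Longrightarrow>
    tcong (TBr (TGen i j) (TGen j k)) (TAdd (TScale 2 (TGen i j)) (TScale 2 (TGen j k)))"
| rel_iii: "distinct [i, j, k, l] \<Longrightarrow>
    tcong (TBr (TGen i j) (TBr (TGen i j) (TBr (TGen i j) (TGen k l))))
          (TScale 4 (TBr (TGen i j) (TGen k l)))"

quotient_type (overloaded) 'a tetra = "'a::field tterm" / tcong
  by (rule equivpI) (blast intro: reflpI sympI transpI tcong.refl tcong.sym tcong.trans)+

instantiation tetra :: (field) ab_group_add
begin

lift_definition zero_tetra :: "'a tetra" is TZero .
lift_definition plus_tetra :: "'a tetra \<Rightarrow> 'a tetra \<Rightarrow> 'a tetra" is TAdd by (rule tcong.cong_add)
lift_definition uminus_tetra :: "'a tetra \<Rightarrow> 'a tetra" is TNeg by (rule tcong.cong_neg)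
lift_definition minus_tetra :: "'a tetra \<Rightarrow> 'a tetra \<Rightarrow> 'a tetra" is "\<lambda>s t. TAdd s (TNeg t)"
  by (intro tcong.cong_add tcong.cong_neg)

instance
  by standard (transfer, rule tcong.add_assoc tcong.add_comm tcong.add_zero tcong.add_neg
    tcong.refl)+

end

lift_definition tscale :: "'a::field \<Rightarrow> 'a tetra \<Rightarrow> 'a tetra" is TScale by (rule tcong.cong_scale)
lift_definition tbracket :: "'a::field tetra \<Rightarrow> 'a tetra \<Rightarrow> 'a tetra" is TBr by (rule tcong.cong_br)
lift_definition tgen :: "4 \<Rightarrow> 4 \<Rightarrow> 'a::field tetra" is TGen .

lemma lie_algebra_tetra: "lie_algebra (tscale :: 'a::field \<Rightarrow> _) tbracket"
  by unfold_locales
    (transfer, rule tcong.scale_add_right tcong.scale_add_left tcong.scale_scale tcong.scale_one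
      tcong.br_add_left tcong.br_add_right tcong.br_scale_left tcong.br_scale_right
      tcong.br_self tcong.jacobi)+

lemma tgen_relations:
  "tgen i i = (0 :: 'a::field tetra)"
  "i \<noteq> j \<Longrightarrow> tgen i j + tgen j i = (0 :: 'a tetra)"
  "distinct [i, j, k] \<Longrightarrow>
    tbracket (tgen i j) (tgen j k) = tscale 2 (tgen i j) + tscale 2 (tgen j k :: 'a tetra)"
  "distinct [i, j, k, l] \<Longrightarrow>
    tbracket (tgen i j) (tbracket (tgen i j) (tbracket (tgen i j) (tgen k l)))
      = tscale 4 (tbracket (tgen i j) (tgen k l :: 'a tetra))"
  by (transfer, erule tcong.rel_i tcong.rel_ii tcong.rel_iii | transfer, rule tcong.gen_diag)+

primrec teval ::
  "('a \<Rightarrow> 'l::ab_group_add \<Rightarrow> 'l) \<Rightarrow> ('l \<Rightarrow> 'l \<Rightarrow> 'l) \<Rightarrow> (4 \<Rightarrow> 4 \<Rightarrow> 'l) \<Rightarrow> 'a tterm \<Rightarrow> 'l"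
  where
    "teval sc br g (TGen i j) = g i j"
  | "teval sc br g TZero = 0"
  | "teval sc br g (TAdd s t) = teval sc br g s + teval sc br g t"
  | "teval sc br g (TNeg s) = - teval sc br g s"
  | "teval sc br g (TScale c s) = sc c (teval sc br g s)"
  | "teval sc br g (TBr s t) = br (teval sc br g s) (teval sc br g t)"

lemma teval_cong:
  fixes sc :: "'a::field \<Rightarrow> 'l::ab_group_add \<Rightarrow> 'l"
  assumes "lie_algebra sc br"
    and "\<And>i. g i i = 0" and "\<And>i j. i \<noteq> j \<Longrightarrow> g i j + g j i = 0"
    and "\<And>i j k. distinct [i, j, k] \<Longrightarrow> br (g i j) (g j k) = sc 2 (g i j) + sc 2 (g j k)"
    and "\<And>i j k l. distinct [i, j, k, l] \<Longrightarrow>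
      br (g i j) (br (g i j) (br (g i j) (g k l))) = sc 4 (br (g i j) (g k l))"
    and "tcong s t"
  shows "teval sc br g s = teval sc br g t"
proof -
  interpret lie_algebra sc br by fact
  from assms(6) show ?thesis
    by (induction rule: tcong.induct)
      (simp_all add: bracket_add_left bracket_add_right bracket_scale_left bracket_scale_right
        bracket_self jacobi[unfolded add.assoc] scale_right_distrib scale_left_distrib assms(2-5) add_ac
        del: distinct.simps)
qed

text \<open>Universal property of the presentation.\<close>

lemma tetra_universal:
  fixes sc :: "'a::field \<Rightarrow> 'l::ab_group_add \<Rightarrow> 'l"
  assumes "lie_algebra sc br"
    and "\<And>i. g i i = 0" and "\<And>i j. i \<noteq> j \<Longrightarrow> g i j + g j i = 0"
    and "\<And>i j k. distinct [i, j, k] \<Longrightarrow> br (g i j) (g j k) = sc 2 (g i j) + sc 2 (g j k)"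
    and "\<And>i j k l. distinct [i, j, k, l] \<Longrightarrow>
      br (g i j) (br (g i j) (br (g i j) (g k l))) = sc 4 (br (g i j) (g k l))"
  shows "\<exists>!\<phi>. lie_hom tscale tbracket sc br \<phi> \<and> (\<forall>i j. \<phi> (tgen i j) = g i j)"
proof -
  interpret M: lie_algebra sc br by fact
  interpret T: lie_algebra "tscale :: 'a \<Rightarrow> _" tbracket by (rule lie_algebra_tetra)
  let ?\<phi> = "\<lambda>u. teval sc br g (rep_tetra u)"
  have eq: "?\<phi> (abs_tetra s) = teval sc br g s" for s :: "'a tterm"
    by (rule teval_cong[OF assms]) (auto intro: Quotient3_rep_abs[OF Quotient3_tetra] tcong.refl)
  have add: "?\<phi> (u + v) = ?\<phi> u + ?\<phi> v" for u v :: "'a tetra"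
    by (induction u; induction v) (simp add: plus_tetra.abs_eq eq)
  have scl: "?\<phi> (tscale c u) = sc c (?\<phi> u)" for c and u :: "'a tetra"
    by (induction u) (simp add: tscale.abs_eq eq)
  have brk: "?\<phi> (tbracket u v) = br (?\<phi> u) (?\<phi> v)" for u v :: "'a tetra"
    by (induction u; induction v) (simp add: tbracket.abs_eq eq)
  have gen: "?\<phi> (tgen i j) = g i j" for i j
    by (simp add: tgen.abs_eq eq)
  have "Vector_Spaces.linear tscale sc ?\<phi>"
    by (simp add: Vector_Spaces.linear_iff add scl M.vector_space_axioms T.vector_space_axioms)
  with brk gen have ex: "lie_hom tscale tbracket sc br ?\<phi> \<and> (\<forall>i j. ?\<phi> (tgen i j) = g i j)"
    by (simp add: lie_hom_def)
  have uniq: "\<psi> = ?\<phi>" if "lie_hom tscale tbracket sc br \<psi> \<and> (\<forall>i j. \<psi> (tgen i j) = g i j)" for \<psi>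
  proof
    fix u :: "'a tetra"
    interpret Vector_Spaces.linear tscale sc \<psi> using that by (simp add: lie_hom_def)
    have "\<psi> (abs_tetra s) = teval sc br g s" for s
    proof (induction s)
      case (TGen i j)
      then show ?case using that by (simp add: tgen.abs_eq[symmetric])
    next
      case TZero
      then show ?case using zero by (simp add: zero_tetra_def)
    next
      case (TAdd s t)
      then show ?case using add[of "abs_tetra s" "abs_tetra t"] by (simp add: plus_tetra.abs_eq)
    next
      case (TNeg s)
      then show ?case using neg[of "abs_tetra s"] by (simp add: uminus_tetra.abs_eq)
    next
      case (TScale c s)
      then show ?case using scale[of c "abs_tetra s"] by (simp add: tscale.abs_eq)
    next
      case (TBr s t)
      have "\<psi> (tbracket (abs_tetra s) (abs_tetra t)) = br (\<psi> (abs_tetra s)) (\<psi> (abs_tetra t))"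
        using that by (simp add: lie_hom_def)
      with TBr show ?case by (simp add: tbracket.abs_eq)
    qed
    then show "\<psi> u = ?\<phi> u" by (induction u) (simp add: eq)
  qed
  show ?thesis using ex uniq by blast
qed

section \<open>The Lie algebra \<open>sl\<^sub>2\<close>\<close>

typedef (overloaded) 'a sl2 = "{A :: 'a::field^2^2. trace A = 0}"
  by (rule exI[of _ 0]) (simp add: trace_def)

setup_lifting type_definition_sl2

instantiation sl2 :: (field) ab_group_add
begin

lift_definition zero_sl2 :: "'a sl2" is 0 by (simp add: trace_def)
lift_definition plus_sl2 :: "'a sl2 \<Rightarrow> 'a sl2 \<Rightarrow> 'a sl2" is "(+)"
  by (simp only: trace_add) simp
lift_definition uminus_sl2 :: "'a sl2 \<Rightarrow> 'a sl2" is uminus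
  by (simp add: trace_def sum_negf)
lift_definition minus_sl2 :: "'a sl2 \<Rightarrow> 'a sl2 \<Rightarrow> 'a sl2" is "(-)"
  by (simp only: trace_sub) simp

instance by standard (transfer, simp)+

end

lift_definition sl2_scale :: "'a::field \<Rightarrow> 'a sl2 \<Rightarrow> 'a sl2" is "\<lambda>c A. \<chi> i j. c * A $ i $ j"
  by (simp add: trace_def sum_distrib_left[symmetric])

lift_definition sl2_bracket :: "'a::field sl2 \<Rightarrow> 'a sl2 \<Rightarrow> 'a sl2" is "\<lambda>A B. A ** B - B ** A"
  by (simp only: trace_sub, subst trace_mul_sym, rule diff_self)

lift_definition sl2_entry :: "'a::field sl2 \<Rightarrow> 2 \<Rightarrow> 2 \<Rightarrow> 'a" is "\<lambda>A i j. A $ i $ j" .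

lift_definition sl2_e :: "'a::field sl2" is "vector [vector [0, 1], vector [0, 0]]"
  by (simp add: trace_def sum_2)
lift_definition sl2_f :: "'a::field sl2" is "vector [vector [0, 0], vector [1, 0]]"
  by (simp add: trace_def sum_2)
lift_definition sl2_h :: "'a::field sl2" is "vector [vector [1, 0], vector [0, - 1]]"
  by (simp add: trace_def sum_2)

lemma sl2_entry_22: "sl2_entry A 2 2 = - sl2_entry A 1 1"
  by transfer (simp add: trace_def sum_2 eq_neg_iff_add_eq_0 add.commute)

lemma sl2_eq_iff:
  "A = B \<longleftrightarrow> sl2_entry A 1 1 = sl2_entry B 1 1 \<and> sl2_entry A 1 2 = sl2_entry B 1 2 \<and>
    sl2_entry A 2 1 = sl2_entry B 2 1"
proof -
  have "A = B \<longleftrightarrow> (\<forall>i j. sl2_entry A i j = sl2_entry B i j)"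
    by transfer (simp add: vec_eq_iff)
  then show ?thesis by (auto simp: forall_2 sl2_entry_22)
qed

lemma sl2_entry_simps:
  "sl2_entry 0 i j = 0"
  "sl2_entry (A + B) i j = sl2_entry A i j + sl2_entry B i j"
  "sl2_entry (A - B) i j = sl2_entry A i j - sl2_entry B i j"
  "sl2_entry (- A) i j = - sl2_entry A i j"
  "sl2_entry (sl2_scale c A) i j = c * sl2_entry A i j"
  "sl2_entry (sl2_bracket A B) i j =
    (\<Sum>k\<in>UNIV. sl2_entry A i k * sl2_entry B k j) - (\<Sum>k\<in>UNIV. sl2_entry B i k * sl2_entry A k j)"
  "sl2_entry sl2_e 1 1 = 0" "sl2_entry sl2_e 1 2 = 1" "sl2_entry sl2_e 2 1 = 0"
  "sl2_entry sl2_f 1 1 = 0" "sl2_entry sl2_f 1 2 = 0" "sl2_entry sl2_f 2 1 = 1"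
  "sl2_entry sl2_h 1 1 = 1" "sl2_entry sl2_h 1 2 = 0" "sl2_entry sl2_h 2 1 = 0"
  by (transfer, simp add: matrix_matrix_mult_def)+

lemma lie_algebra_sl2: "lie_algebra (sl2_scale :: 'a::field \<Rightarrow> _) sl2_bracket"
  by unfold_locales
    (simp_all add: sl2_eq_iff sl2_entry_simps sum_2 sl2_entry_22 algebra_simps)

lemma sl2_relations:
  "sl2_bracket sl2_h sl2_e = sl2_scale 2 (sl2_e :: 'a::field sl2)"
  "sl2_bracket sl2_h sl2_f = sl2_scale (- 2) (sl2_f :: 'a sl2)"
  "sl2_bracket sl2_e sl2_f = (sl2_h :: 'a sl2)"
  by (simp_all add: sl2_eq_iff sl2_entry_simps sum_2 sl2_entry_22)

lemma sl2_basis: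
  "A = sl2_scale (sl2_entry A 1 2) sl2_e + sl2_scale (sl2_entry A 2 1) sl2_f
     + sl2_scale (sl2_entry A 1 1) sl2_h"
  by (simp add: sl2_eq_iff sl2_entry_simps)

definition sl2_x :: "'a::field sl2" where "sl2_x = sl2_scale 2 sl2_e - sl2_h"
definition sl2_y :: "'a::field sl2" where "sl2_y = sl2_scale (- 2) sl2_f - sl2_h"
definition sl2_z :: "'a::field sl2" where "sl2_z = sl2_h"

section \<open>The evaluation homomorphism\<close>

text \<open>The six prescribed values determine the homomorphism, because \<open>tgen j i = - tgen i j\<close>;
  existence and uniqueness for \<open>a \<notin> {0, 1}\<close> are \<open>EV_ex1\<close> below.\<close>

definition is_EV :: "'a::field \<Rightarrow> ('a tetra \<Rightarrow> 'a sl2) \<Rightarrow> bool"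
  where "is_EV a \<phi> \<longleftrightarrow>
    lie_hom tscale tbracket sl2_scale sl2_bracket \<phi> \<and>
    \<phi> (tgen 1 2) = sl2_x \<and> \<phi> (tgen 2 3) = sl2_y \<and> \<phi> (tgen 3 1) = sl2_z \<and>
    \<phi> (tgen 0 3) = sl2_scale a sl2_y + sl2_scale (a - 1) sl2_z \<and>
    \<phi> (tgen 0 1) = sl2_scale (1 - inverse a) sl2_z - sl2_scale (inverse a) sl2_x \<and>
    \<phi> (tgen 0 2) =
      sl2_scale (inverse (1 - a)) sl2_x + sl2_scale (a * inverse (1 - a)) sl2_y"

definition EV :: "'a::field \<Rightarrow> 'a tetra \<Rightarrow> 'a sl2"
  where "EV a = (THE \<phi>. is_EV a \<phi>)"


lemma sl2_ad_cubed:
  assumes "sl2_entry A 1 1 ^ 2 + sl2_entry A 1 2 * sl2_entry A 2 1 = 1"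
  shows "sl2_bracket A (sl2_bracket A (sl2_bracket A B)) = sl2_scale 4 (sl2_bracket A B)"
proof -
  have "sl2_bracket A (sl2_bracket A (sl2_bracket A B)) =
    sl2_scale (4 * (sl2_entry A 1 1 ^ 2 + sl2_entry A 1 2 * sl2_entry A 2 1)) (sl2_bracket A B)"
    by (simp add: sl2_eq_iff sl2_entry_simps sum_2 sl2_entry_22)
      (simp add: algebra_simps power2_eq_square)
  then show ?thesis using assms by simp
qed

lemma EV_ex1:
  fixes a :: "'a::field"
  assumes "a \<noteq> 0" "a \<noteq> 1"
  shows "\<exists>!\<phi>. is_EV a \<phi>"
proof -
  define g :: "4 \<Rightarrow> 4 \<Rightarrow> 'a sl2" where "g = (\<lambda>i j.
    let up = (\<lambda>i j :: 4.
      if (i, j) = (1, 2) then sl2_x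
      else if (i, j) = (2, 3) then sl2_y
      else if (i, j) = (3, 1) then sl2_z
      else if (i, j) = (0, 3) then sl2_scale a sl2_y + sl2_scale (a - 1) sl2_z
      else if (i, j) = (0, 1) then sl2_scale (1 - inverse a) sl2_z - sl2_scale (inverse a) sl2_x
      else if (i, j) = (0, 2) then
        sl2_scale (inverse (1 - a)) sl2_x + sl2_scale (a * inverse (1 - a)) sl2_y
      else 0)
    in up i j - up j i)"
  have four: "(4 :: 4) = 0" by simp
  have g: "g 1 2 = sl2_x" "g 2 3 = sl2_y" "g 3 1 = sl2_z"
    "g 0 3 = sl2_scale a sl2_y + sl2_scale (a - 1) sl2_z"
    "g 0 1 = sl2_scale (1 - inverse a) sl2_z - sl2_scale (inverse a) sl2_x"
    "g 0 2 = sl2_scale (inverse (1 - a)) sl2_x + sl2_scale (a * inverse (1 - a)) sl2_y"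
    by (simp_all add: g_def)
  have g_skew: "g i j = - g j i" for i j
    by (simp add: g_def Let_def)
  have g_sum: "g i j + g j i = 0" for i j
    by (subst g_skew) simp
  have g_diag: "g i i = 0" for i
    by (simp add: g_def Let_def)
  have g': "g 2 1 = - sl2_x" "g 3 2 = - sl2_y" "g 1 3 = - sl2_z"
    "g 3 0 = - (sl2_scale a sl2_y + sl2_scale (a - 1) sl2_z)"
    "g 1 0 = - (sl2_scale (1 - inverse a) sl2_z - sl2_scale (inverse a) sl2_x)"
    "g 2 0 = - (sl2_scale (inverse (1 - a)) sl2_x + sl2_scale (a * inverse (1 - a)) sl2_y)"
    using g_skew g by metis+
  have "1 - a \<noteq> 0" using assms by simp
  note entry = sl2_eq_iff sl2_entry_simps sl2_entry_22 sum_2 sl2_x_def sl2_y_def sl2_z_def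
  have ii: "distinct [i, j, k] \<Longrightarrow>
      sl2_bracket (g i j) (g j k) = sl2_scale 2 (g i j) + sl2_scale 2 (g j k)" for i j k
    using exhaust_4[of i] exhaust_4[of j] exhaust_4[of k] assms \<open>1 - a \<noteq> 0\<close> unfolding four
    by (elim disjE) (simp_all add: g g' entry divide_simps, simp_all add: algebra_simps)
  have q: "sl2_entry (g i j) 1 1 ^ 2 + sl2_entry (g i j) 1 2 * sl2_entry (g i j) 2 1 = 1"
    if "i \<noteq> j" for i j
    using exhaust_4[of i] exhaust_4[of j] that assms \<open>1 - a \<noteq> 0\<close> unfolding four
    by (elim disjE)
      (simp_all add: g g' entry divide_simps, simp_all add: algebra_simps power2_eq_square)
  have iii: "distinct [i, j, k, l] \<Longrightarrow>
      sl2_bracket (g i j) (sl2_bracket (g i j) (sl2_bracket (g i j) (g k l)))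
        = sl2_scale 4 (sl2_bracket (g i j) (g k l))" for i j k l
    by (rule sl2_ad_cubed, rule q) simp
  have "\<exists>!\<phi>. lie_hom tscale tbracket sl2_scale sl2_bracket \<phi> \<and> (\<forall>i j. \<phi> (tgen i j) = g i j)"
    by (rule tetra_universal[OF lie_algebra_sl2 g_diag g_sum ii iii])
  moreover have "(lie_hom tscale tbracket sl2_scale sl2_bracket \<phi> \<and> (\<forall>i j. \<phi> (tgen i j) = g i j))
      \<longleftrightarrow> is_EV a \<phi>" for \<phi>
  proof
    assume *: "is_EV a \<phi>"
    then interpret Vector_Spaces.linear tscale sl2_scale \<phi> by (simp add: is_EV_def lie_hom_def)
    have skew: "\<phi> (tgen j i) = - \<phi> (tgen i j)" for i j
      by (metis tgen_relations(1,2) neg add_eq_0_iff neg_equal_zero add.inverse_neutral)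
    have diag: "\<phi> (tgen i i) = 0" for i
      by (simp add: tgen_relations(1) zero)
    have up: "\<phi> (tgen 1 2) = g 1 2" "\<phi> (tgen 2 3) = g 2 3" "\<phi> (tgen 3 1) = g 3 1"
      "\<phi> (tgen 0 3) = g 0 3" "\<phi> (tgen 0 1) = g 0 1" "\<phi> (tgen 0 2) = g 0 2"
      using * by (simp_all add: is_EV_def g)
    then have "\<phi> (tgen 2 1) = g 2 1" "\<phi> (tgen 3 2) = g 3 2" "\<phi> (tgen 1 3) = g 1 3"
      "\<phi> (tgen 3 0) = g 3 0" "\<phi> (tgen 1 0) = g 1 0" "\<phi> (tgen 2 0) = g 2 0"
      by (metis skew g_skew)+
    with up have "\<forall>i j. \<phi> (tgen i j) = g i j"
      unfolding forall_4 four by (simp add: diag g_diag)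
    with * show "lie_hom tscale tbracket sl2_scale sl2_bracket \<phi> \<and> (\<forall>i j. \<phi> (tgen i j) = g i j)"
      by (simp add: is_EV_def)
  qed (simp add: is_EV_def g)
  ultimately show ?thesis by simp
qed

lemma is_EV_EV: "a \<noteq> 0 \<Longrightarrow> a \<noteq> 1 \<Longrightarrow> is_EV a (EV a)"
  unfolding EV_def by (rule theI'[OF EV_ex1])

section \<open>The modules \<open>V\<^sub>d\<close> and evaluation modules\<close>

text \<open>\<open>V\<^sub>d\<close> is realized as the polynomials of degree at most \<open>d\<close> in one variable \<open>t\<close>, i.e. the
  dehomogenized binary forms of degree \<open>d\<close>:
  \<open>e p = p'\<close>, \<open>f p = d t p - t\<^sup>2 p'\<close>, \<open>h p = d p - 2 t p'\<close>. The lemmas \<open>lie_module_Vd\<close>, \<open>dim_Vd\<close> and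
  \<open>irreducible_Vd\<close> show that it is an irreducible \<open>sl\<^sub>2\<close>-module of dimension \<open>d + 1\<close>.\<close>

definition Vd :: "nat \<Rightarrow> 'a::field poly set"
  where "Vd d = {p. degree p \<le> d}"

definition Vd_act :: "nat \<Rightarrow> 'a::field sl2 \<Rightarrow> 'a poly \<Rightarrow> 'a poly"
  where "Vd_act d A p =
    smult (sl2_entry A 1 2) (pderiv p)
    + smult (sl2_entry A 2 1) (smult (of_nat d) ([:0, 1:] * p) - [:0, 1:]^2 * pderiv p)
    + smult (sl2_entry A 1 1) (smult (of_nat d) p - smult 2 ([:0, 1:] * pderiv p))"

lemma vector_space_smult: "vector_space (smult :: 'a::field \<Rightarrow> 'a poly \<Rightarrow> 'a poly)"
  by unfold_locales (simp_all add: smult_add_right smult_add_left)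

lemma subspace_Vd: "module.subspace smult (Vd d)"
proof -
  interpret vector_space "smult :: 'a \<Rightarrow> 'a poly \<Rightarrow> 'a poly" by (rule vector_space_smult)
  show ?thesis by (rule subspaceI) (auto simp: Vd_def degree_add_le)
qed

lemma coeff_Vd_act:
  "coeff (Vd_act d A p) n =
    sl2_entry A 1 2 * of_nat (Suc n) * coeff p (Suc n)
    + sl2_entry A 2 1 * (if n = 0 then 0 else (of_nat d - of_nat (n - 1)) * coeff p (n - 1))
    + sl2_entry A 1 1 * (of_nat d - 2 * of_nat n) * coeff p n"
  by (cases n; cases "n - 1")
    (auto simp: Vd_act_def power2_eq_square coeff_pCons coeff_pderiv algebra_simps)

lemma Vd_act_closed:
  assumes "p \<in> Vd d"
  shows "Vd_act d A p \<in> Vd d"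
proof -
  have "coeff (Vd_act d A p) i = 0" if "d < i" for i
  proof -
    have "coeff p i = 0" "coeff p (Suc i) = 0" "i - 1 = d \<or> coeff p (i - 1) = 0"
      using assms that by (auto simp: Vd_def intro!: coeff_eq_0)
    then show ?thesis by (auto simp: coeff_Vd_act)
  qed
  then show ?thesis unfolding Vd_def by (simp add: degree_le)
qed

lemma lie_module_Vd:
  "lie_module sl2_scale sl2_bracket smult (Vd d) (Vd_act d :: 'a::field sl2 \<Rightarrow> _)"
proof -
  interpret L: lie_algebra "sl2_scale :: 'a \<Rightarrow> _" sl2_bracket by (rule lie_algebra_sl2)
  interpret V: vector_space "smult :: 'a \<Rightarrow> 'a poly \<Rightarrow> 'a poly" by (rule vector_space_smult)
  have br: "Vd_act d (sl2_bracket x y) p = Vd_act d x (Vd_act d y p) - Vd_act d y (Vd_act d x p)"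
    for x y :: "'a sl2" and p
  proof (rule poly_eqI)
    fix n
    consider "n = 0" | "n = 1" | m where "n = Suc (Suc m)" by (metis One_nat_def not0_implies_Suc)
    then show "coeff (Vd_act d (sl2_bracket x y) p) n =
        coeff (Vd_act d x (Vd_act d y p) - Vd_act d y (Vd_act d x p)) n"
      by cases (simp_all add: coeff_Vd_act sl2_entry_simps sum_2 sl2_entry_22 algebra_simps)
  qed
  show ?thesis
    by unfold_locales
      (simp_all add: subspace_Vd Vd_act_closed br, simp_all add: Vd_act_def sl2_entry_simps
        pderiv_add pderiv_smult smult_add_right smult_add_left smult_diff_right algebra_simps)
qed

lemma poly_as_sum_Vd:
  assumes "p \<in> Vd d"
  shows "p = (\<Sum>i\<le>d. smult (coeff p i) (monom 1 i))"
proof -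
  have "p = (\<Sum>i\<le>d. monom (coeff p i) i)"
    using assms by (intro poly_as_sum_of_monoms'[symmetric]) (simp add: Vd_def)
  then show ?thesis by (simp add: smult_monom)
qed

lemma dim_Vd: "vector_space.dim smult (Vd d :: 'a::field poly set) = d + 1"
proof -
  interpret V: vector_space "smult :: 'a \<Rightarrow> 'a poly \<Rightarrow> 'a poly" by (rule vector_space_smult)
  let ?B = "(monom 1 :: nat \<Rightarrow> 'a poly) ` {..d}"
  have inj: "inj_on (monom 1 :: nat \<Rightarrow> 'a poly) {..d}"
    by (auto intro!: inj_onI simp: monom_eq_iff')
  show ?thesis
  proof (rule V.dim_unique)
    show "?B \<subseteq> Vd d" by (auto simp: Vd_def degree_monom_eq)
    show "Vd d \<subseteq> V.span ?B"
    proof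
      fix p :: "'a poly" assume "p \<in> Vd d"
      then have "p = (\<Sum>i\<le>d. smult (coeff p i) (monom 1 i))" by (rule poly_as_sum_Vd)
      also have "\<dots> \<in> V.span ?B"
        by (intro V.span_sum V.span_scale V.span_base) simp
      finally show "p \<in> V.span ?B" .
    qed
    show "V.independent ?B"
    proof (rule V.independent_if_scalars_zero)
      fix f and v :: "'a poly"
      assume 0: "(\<Sum>x\<in>?B. smult (f x) x) = 0" and "v \<in> ?B"
      then obtain i where i: "i \<le> d" "v = monom 1 i" by auto
      have "(\<Sum>j\<le>d. monom (f (monom 1 j)) j) = 0"
        using 0 by (simp add: sum.reindex[OF inj] smult_monom)
      then have "coeff (\<Sum>j\<le>d. monom (f (monom 1 j)) j) i = 0" by simp
      then have "(\<Sum>j\<le>d. if j = i then f (monom 1 j) else 0) = 0"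
        by (simp add: coeff_sum coeff_monom)
      then show "f v = 0" using i by simp
    qed simp
    show "card ?B = d + 1" by (simp add: card_image[OF inj])
  qed
qed

lemma irreducible_Vd:
  "irreducible_action smult (Vd d) (Vd_act d :: 'a::field_char_0 sl2 \<Rightarrow> _)"
proof -
  interpret V: vector_space "smult :: 'a \<Rightarrow> 'a poly \<Rightarrow> 'a poly" by (rule vector_space_smult)
  have "W = Vd d"
    if W: "V.subspace W" "W \<subseteq> Vd d" "\<And>A w. w \<in> W \<Longrightarrow> Vd_act d A w \<in> W" and "W \<noteq> {0}" for W
  proof -
    have e: "pderiv p \<in> W" if "p \<in> W" for p
      using W(3)[OF that, of sl2_e] by (simp add: Vd_act_def sl2_entry_simps)
    have one: "1 \<in> W" if "p \<in> W" "p \<noteq> 0" "degree p = m" for p m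
      using that
    proof (induction m arbitrary: p)
      case 0
      then obtain c where c: "p = [:c:]" "c \<noteq> 0" by (metis degree_eq_zeroE pCons_0_0)
      with V.subspace_scale[OF W(1) 0(1), of "1 / c"] show ?case by (simp add: one_pCons)
    next
      case (Suc m)
      then have "degree (pderiv p) = m" "pderiv p \<noteq> 0"
        by (simp_all add: degree_pderiv pderiv_eq_0_iff)
      with Suc.IH e Suc.prems(1) show ?case by blast
    qed
    from \<open>W \<noteq> {0}\<close> V.subspace_0[OF W(1)] obtain p where "p \<in> W" "p \<noteq> 0" by blast
    with one have "1 \<in> W" by blast
    have mon: "i \<le> d \<Longrightarrow> monom 1 i \<in> W" for i
    proof (induction i)
      case 0
      with \<open>1 \<in> W\<close> show ?case by simp
    next
      case (Suc i)
      have "Vd_act d sl2_f (monom 1 i) = smult (of_nat d - of_nat i) (monom 1 (Suc i))"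
        by (rule poly_eqI) (auto simp: coeff_Vd_act sl2_entry_simps coeff_monom)
      then have "smult (of_nat d - of_nat i) (monom 1 (Suc i)) \<in> W"
        using W(3)[of "monom 1 i" sl2_f] Suc by (metis Suc_leD)
      from V.subspace_scale[OF W(1) this, of "1 / (of_nat d - of_nat i)"] Suc.prems
      show ?case by simp
    qed
    have "Vd d \<subseteq> W"
    proof
      fix p :: "'a poly" assume "p \<in> Vd d"
      then have "p = (\<Sum>i\<le>d. smult (coeff p i) (monom 1 i))" by (rule poly_as_sum_Vd)
      also have "\<dots> \<in> W" using mon by (intro V.subspace_sum V.subspace_scale W(1)) simp
      finally show "p \<in> W" .
    qed
    with W(2) show "W = Vd d" by simp
  qed
  moreover have "Vd d \<noteq> ({0} :: 'a poly set)"
  proof -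
    have "(1 :: 'a poly) \<in> Vd d" by (simp add: Vd_def)
    then show ?thesis by (metis singletonD zero_neq_one)
  qed
  ultimately show ?thesis
    unfolding irreducible_action_def by (intro conjI allI impI) (assumption, metis)
qed

text \<open>The action of the evaluation module \<open>V\<^sub>d(a)\<close>, whose underlying space is \<open>Vd d\<close>.\<close>

definition evaluation_act :: "nat \<Rightarrow> 'a::field \<Rightarrow> 'a tetra \<Rightarrow> 'a poly \<Rightarrow> 'a poly"
  where "evaluation_act d a u = Vd_act d (EV a u)"

section \<open>Diameter and shape\<close>

abbreviation tetra_module ::
  "('a::field \<Rightarrow> 'v::ab_group_add \<Rightarrow> 'v) \<Rightarrow> 'v set \<Rightarrow> ('a tetra \<Rightarrow> 'v \<Rightarrow> 'v) \<Rightarrow> bool"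
  where "tetra_module \<equiv> lie_module tscale tbracket"

definition eigenspace ::
  "('a::field \<Rightarrow> 'v::ab_group_add \<Rightarrow> 'v) \<Rightarrow> 'v set \<Rightarrow> ('v \<Rightarrow> 'v) \<Rightarrow> 'a \<Rightarrow> 'v set"
  where "eigenspace sc V T c = {v \<in> V. T v = sc c v}"

definition eigenvalues ::
  "('a::field \<Rightarrow> 'v::ab_group_add \<Rightarrow> 'v) \<Rightarrow> 'v set \<Rightarrow> ('v \<Rightarrow> 'v) \<Rightarrow> 'a set"
  where "eigenvalues sc V T = {c. \<exists>v\<in>V. v \<noteq> 0 \<and> T v = sc c v}"

definition has_diameter ::
  "('a::field \<Rightarrow> 'v::ab_group_add \<Rightarrow> 'v) \<Rightarrow> 'v set \<Rightarrow> ('a tetra \<Rightarrow> 'v \<Rightarrow> 'v) \<Rightarrow> nat \<Rightarrow> bool"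
  where "has_diameter sc V act d \<longleftrightarrow>
    (\<forall>i j. i \<noteq> j \<longrightarrow>
      eigenvalues sc V (act (tgen i j)) = {of_nat d - 2 * of_nat n |n. n \<le> d})"

text \<open>By a theorem of Hartwig, every finite-dimensional irreducible module over an algebraically closed
  field of characteristic 0 has exactly one shape.\<close>

definition has_shape ::
  "('a::field \<Rightarrow> 'v::ab_group_add \<Rightarrow> 'v) \<Rightarrow> 'v set \<Rightarrow> ('a tetra \<Rightarrow> 'v \<Rightarrow> 'v) \<Rightarrow> nat list \<Rightarrow> bool"
  where "has_shape sc V act \<rho> \<longleftrightarrow>
    (\<exists>d. has_diameter sc V act d \<and> length \<rho> = d + 1 \<and>
      (\<forall>i j n. i \<noteq> j \<and> n \<le> d \<longrightarrow>
        vector_space.dim sc (eigenspace sc V (act (tgen i j)) (2 * of_nat n - of_nat d)) = \<rho> ! n))"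

end

theory Submission
  imports Defs
begin

text \<open>
  If \<open>V\<close> is an evaluation module, each \<open>x\<^sub>i\<^sub>j\<close> acts through an element of \<open>sl\<^sub>2\<close> of determinant \<open>-1\<close>,
  which has eigenvectors \<open>l, m\<close> of eigenvalues \<open>1, -1\<close> among the linear polynomials; the products
  \<open>l\<^sup>n m\<^sup>d\<^sup>-\<^sup>n\<close> are then an eigenbasis of \<open>V\<^sub>d\<close> with distinct eigenvalues.

  Conversely, by relations (ii) and (iii) the sum of the eigenspaces of \<open>x\<^sub>i\<^sub>j\<close> is a submodule, so
  \<open>x\<^sub>3\<^sub>1\<close> is diagonalizable by irreducibility, and if its eigenspaces are lines then \<open>V\<close> is \<open>V\<^sub>d\<close> under
  the \<open>sl\<^sub>2\<close>-triple \<open>e, f, h\<close> with \<open>x\<^sub>1\<^sub>2 = 2e - h\<close>, \<open>x\<^sub>2\<^sub>3 = -2f - h\<close>, \<open>x\<^sub>3\<^sub>1 = h\<close>. Also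
  \<open>x\<^sub>1\<^sub>0 = 2e' - h\<close> and \<open>x\<^sub>0\<^sub>3 = -2f' - h\<close> for a second triple \<open>e', f', h\<close>. Since \<open>f'\<close> commutes with \<open>f\<close>
  and lowers weights, \<open>f' = a f\<close> for a scalar \<open>a\<close>, and then \<open>a e' = e\<close>. The relations between \<open>x\<^sub>0\<^sub>2\<close> and
  the other generators now form a linear system that determines \<open>x\<^sub>0\<^sub>2\<close>.
\<close>

section \<open>Induction over the tetrahedron algebra and independence of eigenvectors\<close>

lemma tetra_induct [case_names gen zero add scale bracket]:
  fixes u :: "'a::field tetra"
  assumes "\<And>i j. P (tgen i j)" and "P 0"
    and "\<And>u v. P u \<Longrightarrow> P v \<Longrightarrow> P (u + v)"
    and "\<And>c u. P u \<Longrightarrow> P (tscale c u)"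
    and "\<And>u v. P u \<Longrightarrow> P v \<Longrightarrow> P (tbracket u v)"
  shows "P u"
proof -
  interpret lie_algebra "tscale :: 'a \<Rightarrow> _" tbracket by (rule lie_algebra_tetra)
  \<comment> \<open>Negation needs no case of its own: it is multiplication by
    \<open>- 1\<close>.\<close>
  have "P (- u)" if "P u" for u
    using assms(4)[OF that, of "- 1"] by simp
  then have "P (abs_tetra s)" for s
    using assms
    by (induction s) (simp_all add: tgen.abs_eq[symmetric] zero_tetra_def[symmetric]
      plus_tetra.abs_eq[symmetric] uminus_tetra.abs_eq[symmetric] tscale.abs_eq[symmetric]
      tbracket.abs_eq[symmetric])
  then show ?thesis by (induction u)
qed

context vector_space
begin

text \<open>The operator \<open>T - c k\<close> kills the summand \<open>v k\<close> and multiplies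
  every other one by the nonzero scalar \<open>c i - c k\<close>, so induction on \<open>I\<close>
  applies. Linearity of \<open>T\<close> is asked on \<open>U\<close> only, because a module action
  is unconstrained outside its underlying space.\<close>

lemma sum_eigenvectors_eq_0:
  assumes "finite I" and "subspace U"
    and add: "\<And>u v. u \<in> U \<Longrightarrow> v \<in> U \<Longrightarrow> T (u + v) = T u + T v"
    and mult: "\<And>c v. v \<in> U \<Longrightarrow> T (scale c v) = scale c (T v)"
    and "\<And>i. i \<in> I \<Longrightarrow> v i \<in> U" and "\<And>i. i \<in> I \<Longrightarrow> T (v i) = scale (c i) (v i)"
    and "inj_on c I" and "(\<Sum>i\<in>I. v i) = 0" and "i \<in> I"
  shows "v i = 0"
  using assms(1,5-)
proof (induction I arbitrary: v i rule: finite_induct)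
  case (insert k I)
  have T0: "T 0 = 0" using mult[of 0 0] subspace_0[OF \<open>subspace U\<close>] by simp
  have Tsum: "T (\<Sum>i\<in>J. w i) = (\<Sum>i\<in>J. T (w i)) \<and> (\<Sum>i\<in>J. w i) \<in> U"
    if "finite J" "\<And>i. i \<in> J \<Longrightarrow> w i \<in> U" for J w
    using that by (induction J rule: finite_induct)
      (auto simp: T0 add subspace_0 subspace_add \<open>subspace U\<close>)
  have "T (\<Sum>i\<in>insert k I. v i) - scale (c k) (\<Sum>i\<in>insert k I. v i) = 0"
    using insert.prems T0 by simp
  also have "T (\<Sum>i\<in>insert k I. v i) = (\<Sum>i\<in>insert k I. scale (c i) (v i))"
    using Tsum[of "insert k I" v] insert by simp
  finally have "(\<Sum>i\<in>I. scale (c i - c k) (v i)) = 0"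
    using insert.hyps
    by (simp add: scale_sum_right scale_right_distrib scale_left_diff_distrib sum_subtractf)
  then have "scale (c i - c k) (v i) = 0" if "i \<in> I" for i
    using insert.IH[of "\<lambda>i. scale (c i - c k) (v i)" i] insert.prems that
    by (simp add: mult subspace_scale[OF \<open>subspace U\<close>] mult.commute inj_on_insert)
  then have I0: "v i = 0" if "i \<in> I" for i
    using that insert.hyps insert.prems(3) by (auto simp: inj_on_def)
  then show ?case using insert.prems(4,5) insert.hyps by auto
qed simp

lemma dim_eq_1_iff: "subspace S \<Longrightarrow> dim S = 1 \<longleftrightarrow> (\<exists>v. v \<noteq> 0 \<and> S = range (\<lambda>c. scale c v))"
proof
  assume "subspace S" "dim S = 1"
  obtain B where B: "B \<subseteq> S" "independent B" "S \<subseteq> span B" "card B = dim S"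
    by (rule basis_exists)
  with \<open>dim S = 1\<close> obtain v where "B = {v}" by (metis card_1_singletonE)
  moreover have "span B = S" using B \<open>subspace S\<close> by (simp add: span_subspace)
  ultimately show "\<exists>v. v \<noteq> 0 \<and> S = range (\<lambda>c. scale c v)"
    using B(2) by (auto simp: span_singleton dependent_single)
next
  assume "\<exists>v. v \<noteq> 0 \<and> S = range (\<lambda>c. scale c v)"
  then obtain v where "v \<noteq> 0" "S = span {v}" by (auto simp: span_singleton)
  then show "dim S = 1" using dim_span_eq_card_independent[of "{v}"] by (simp add: dependent_single)
qed

end

lemma EV_gen:
  assumes "a \<noteq> 0" "a \<noteq> (1::'a::field)"
  shows "EV a (tgen 1 2) = sl2_x" "EV a (tgen 2 3) = sl2_y" "EV a (tgen 3 1) = sl2_z"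
    "EV a (tgen 0 3) = sl2_scale a sl2_y + sl2_scale (a - 1) sl2_z"
    "EV a (tgen 0 1) = sl2_scale (1 - inverse a) sl2_z - sl2_scale (inverse a) sl2_x"
    "EV a (tgen 0 2) = sl2_scale (inverse (1 - a)) sl2_x + sl2_scale (a * inverse (1 - a)) sl2_y"
  using is_EV_EV[OF assms] by (simp_all add: is_EV_def)

lemma EV_hom:
  assumes "a \<noteq> 0" "a \<noteq> (1::'a::field)"
  shows "EV a 0 = 0" "EV a (u + v) = EV a u + EV a v" "EV a (- u) = - EV a u"
    "EV a (tscale c u) = sl2_scale c (EV a u)"
    "EV a (tbracket u v) = sl2_bracket (EV a u) (EV a v)"
proof -
  interpret Vector_Spaces.linear tscale sl2_scale "EV a"
    using is_EV_EV[OF assms] by (simp add: is_EV_def lie_hom_def)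
  show "EV a 0 = 0" "EV a (u + v) = EV a u + EV a v" "EV a (- u) = - EV a u"
    "EV a (tscale c u) = sl2_scale c (EV a u)"
    by (fact zero add neg scale)+
  show "EV a (tbracket u v) = sl2_bracket (EV a u) (EV a v)"
    using is_EV_EV[OF assms] by (simp add: is_EV_def lie_hom_def)
qed

lemma tgen_skew: "tgen j i = (- tgen i j :: 'a::field tetra)"
  using tgen_relations(1,2)[where 'a='a] by (cases "i = j") (auto simp: eq_neg_iff_add_eq_0)

section \<open>The shape of an evaluation module\<close>

text \<open>The generators act on \<open>V\<^sub>1\<close> with eigenvalues \<open>1\<close> and \<open>- 1\<close>, the roots of \<open>s\<^sup>2 = - det A\<close>.\<close>

lemma EV_gen_det:
  fixes a :: "'a::field"
  assumes "a \<noteq> 0" "a \<noteq> 1" "i \<noteq> j"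
  shows "sl2_entry (EV a (tgen i j)) 1 1 ^ 2
    + sl2_entry (EV a (tgen i j)) 1 2 * sl2_entry (EV a (tgen i j)) 2 1 = 1" (is "?q i j = 1")
proof -
  have four: "(4 :: 4) = 0" by simp
  have "1 - a \<noteq> 0" using assms by simp
  have skew: "?q j i = ?q i j" for i j
    using tgen_skew[of i j, where 'a='a] by (simp add: EV_hom[OF assms(1,2)] sl2_entry_simps)
  have "?q 1 2 = 1" "?q 2 3 = 1" "?q 3 1 = 1" "?q 0 3 = 1" "?q 0 1 = 1" "?q 0 2 = 1"
    using assms \<open>1 - a \<noteq> 0\<close>
    by (simp_all add: EV_gen[OF assms(1,2)] sl2_entry_simps sl2_x_def sl2_y_def sl2_z_def divide_simps,
        simp_all add: algebra_simps power2_eq_square)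
  then show ?thesis
    using exhaust_4[of i] exhaust_4[of j] \<open>i \<noteq> j\<close> unfolding four
    by (elim disjE) (simp_all, simp_all add: skew)
qed

lemma Vd_act_add: "Vd_act d A (p + q) = Vd_act d A p + Vd_act d A q"
  by (simp add: Vd_act_def pderiv_add smult_add_right smult_diff_right algebra_simps)

lemma Vd_act_smult: "Vd_act d A (smult c p) = smult c (Vd_act d A p)"
  by (simp add: Vd_act_def pderiv_smult smult_add_right smult_diff_right algebra_simps)

lemma Vd_act_sum: "Vd_act d A (\<Sum>i\<in>I. r i) = (\<Sum>i\<in>I. Vd_act d A (r i))"
proof -
  have "Vd_act d A 0 = 0" by (simp add: Vd_act_def)
  then show ?thesis by (induction I rule: infinite_finite_induct) (simp_all add: Vd_act_add)
qed

text \<open>On binary forms \<open>A\<close> acts as a derivation, and multiplying forms adds their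
  degrees.\<close>

lemma Vd_act_mult:
  fixes A :: "'a::field_char_0 sl2"
  shows "Vd_act (m + n) A (p * q) = Vd_act m A p * q + p * Vd_act n A q"
  by (rule poly_ext) (simp add: Vd_act_def pderiv_mult algebra_simps)

lemma Vd_act_power:
  fixes A :: "'a::field_char_0 sl2"
  assumes "Vd_act 1 A l = smult s l"
  shows "Vd_act n A (l ^ n) = smult (of_nat n * s) (l ^ n)"
proof (induction n)
  case 0
  show ?case by (rule poly_eqI) (simp add: Vd_act_def)
next
  case (Suc n)
  then show ?case using Vd_act_mult[of 1 n A l "l ^ n"] assms
    by (simp add: algebra_simps smult_add_left[symmetric])
qed

lemma Vd_1_eigenvector:
  fixes A :: "'a::field_char_0 sl2"
  assumes "sl2_entry A 1 1 ^ 2 + sl2_entry A 1 2 * sl2_entry A 2 1 = 1" and "s ^ 2 = 1"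
  shows "\<exists>l. l \<noteq> 0 \<and> degree l \<le> 1 \<and> Vd_act 1 A l = smult s l"
proof (intro exI conjI)
  let ?b = "sl2_entry A 1 2" and ?c = "sl2_entry A 2 1" and ?k = "sl2_entry A 1 1"
  \<comment> \<open>In the basis 1, t of linear polynomials the first row of \<open>A - s\<close> is
    \<open>(?k - s, ?b)\<close>; \<open>[:?b, s - ?k:]\<close> spans its kernel unless the row
    vanishes, and then \<open>[:2 * s, ?c:]\<close> solves the second row.\<close>
  define l where "l = (if ?b = 0 \<and> ?k = s then [:2 * s, ?c:] else [:?b, s - ?k:])"
  show "l \<noteq> 0" "degree l \<le> 1" using assms(2) by (auto simp: l_def)
  \<comment> \<open>This says that \<open>A - s\<close> has determinant 0, so the kernel vector of
    the first row also satisfies the second.\<close>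
  have "?c * ?b = (s - ?k) * (s + ?k)"
    using assms by (simp add: algebra_simps power2_eq_square)
  then show "Vd_act 1 A l = smult s l"
    by (auto simp: l_def Vd_act_def pderiv_pCons algebra_simps power2_eq_square)
qed

lemma Vd_eigenvectors:
  fixes A :: "'a::field_char_0 sl2"
  assumes "sl2_entry A 1 1 ^ 2 + sl2_entry A 1 2 * sl2_entry A 2 1 = 1"
  obtains p where "\<And>n. n \<le> d \<Longrightarrow> p n \<in> Vd d" "\<And>n. n \<le> d \<Longrightarrow> p n \<noteq> 0"
    "\<And>n. n \<le> d \<Longrightarrow> Vd_act d A (p n) = smult (2 * of_nat n - of_nat d) (p n)"
proof -
  obtain l where l: "l \<noteq> 0" "degree l \<le> 1" "Vd_act 1 A l = smult 1 l"
    using Vd_1_eigenvector[OF assms, of 1] by auto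
  obtain m where m: "m \<noteq> 0" "degree m \<le> 1" "Vd_act 1 A m = smult (- 1) m"
    using Vd_1_eigenvector[OF assms, of "- 1"] by auto
  show ?thesis
  proof
    fix n assume "n \<le> d"
    let ?p = "l ^ n * m ^ (d - n)"
    show "?p \<noteq> 0" using l m by simp
    have "degree ?p \<le> degree (l ^ n) + degree (m ^ (d - n))" by (rule degree_mult_le)
    also have "\<dots> \<le> degree l * n + degree m * (d - n)" by (intro add_mono degree_power_le)
    also have "\<dots> \<le> 1 * n + 1 * (d - n)" using l m by (intro add_mono mult_right_mono) auto
    finally show "?p \<in> Vd d" using \<open>n \<le> d\<close> by (simp add: Vd_def)
    show "Vd_act d A ?p = smult (2 * of_nat n - of_nat d) ?p"
      using Vd_act_mult[of n "d - n" A "l ^ n" "m ^ (d - n)"] \<open>n \<le> d\<close>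
        Vd_act_power[OF l(3)] Vd_act_power[OF m(3)]
      by (simp add: of_nat_diff smult_add_left[symmetric] algebra_simps)
  qed
qed


text \<open>The \<open>d + 1\<close> eigenvectors from \<open>Vd_eigenvectors\<close> have distinct
  eigenvalues in a space spanned by \<open>d + 1\<close> monomials, so they form a basis; in its
  coordinates every eigenvector is a multiple of one of them.\<close>

lemma Vd_eigenspace:
  fixes A :: "'a::field_char_0 sl2"
  assumes "sl2_entry A 1 1 ^ 2 + sl2_entry A 1 2 * sl2_entry A 2 1 = 1"
  shows "eigenvalues smult (Vd d) (Vd_act d A) = {of_nat d - 2 * of_nat n |n. n \<le> d}"
      (is ?eigenvalues)
    and "n \<le> d \<Longrightarrow> \<exists>p. p \<noteq> 0 \<and>
      eigenspace smult (Vd d) (Vd_act d A) (2 * of_nat n - of_nat d) = range (\<lambda>c. smult c p)"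
      (is "_ \<Longrightarrow> ?eigenspace n")
proof -
  interpret M: lie_module sl2_scale sl2_bracket smult "Vd d" "Vd_act d :: 'a sl2 \<Rightarrow> _"
    by (rule lie_module_Vd)
  obtain p where p: "\<And>n. n \<le> d \<Longrightarrow> p n \<in> Vd d" "\<And>n. n \<le> d \<Longrightarrow> p n \<noteq> 0"
    "\<And>n. n \<le> d \<Longrightarrow> Vd_act d A (p n) = smult (2 * of_nat n - of_nat d) (p n)"
    using Vd_eigenvectors[OF assms] by metis
  let ?c = "\<lambda>n. 2 * of_nat n - of_nat d :: 'a"
  have independent: "\<forall>i\<in>I. r i = 0"
    if "finite I" "inj_on c I" "(\<Sum>i\<in>I. r i) = 0"
      "\<And>i. i \<in> I \<Longrightarrow> r i \<in> Vd d \<and> Vd_act d A (r i) = smult (c i) (r i)"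
    for I :: "nat set" and r and c :: "nat \<Rightarrow> 'a"
    using M.V.sum_eigenvectors_eq_0[OF that(1) M.subspace, of "Vd_act d A" r c] that
    by (auto simp: M.act_add_right M.act_scale_right)
  have c_inj: "inj_on ?c {..d}" by (auto simp: inj_on_def)
  have zero: "\<forall>i\<le>d. b i = 0" if "(\<Sum>i\<le>d. smult (b i) (p i)) = 0" for b
    using independent[OF _ c_inj that] p M.V.subspace_scale[OF M.subspace]
    by (auto simp: M.act_scale_right mult.commute)
  have p_inj: "inj_on p {..d}"
  proof (rule inj_onI)
    fix i j assume ij: "i \<in> {..d}" "j \<in> {..d}" "p i = p j"
    then have "smult (?c i) (p i) = smult (?c j) (p i)" using p(3) by (metis atMost_iff)
    then have "i = j \<or> p i = 0" using ij(3) by auto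
    moreover have "p i \<noteq> 0" using p(2) ij(1) by simp
    ultimately show "i = j" by simp
  qed
  \<comment> \<open>A vector \<open>q\<close> outside the span would give \<open>d + 2\<close>
    independent vectors in the span of \<open>d + 1\<close> monomials.\<close>
  have span: "q \<in> M.V.span (p ` {..d})" if "q \<in> Vd d" for q
  proof (rule ccontr)
    assume q: "q \<notin> M.V.span (p ` {..d})"
    have "M.V.independent (p ` {..d})"
    proof (rule M.V.independent_if_scalars_zero)
      fix f x assume "(\<Sum>x\<in>p ` {..d}. smult (f x) x) = 0" "x \<in> p ` {..d}"
      then show "f x = 0" using zero[of "\<lambda>i. f (p i)"] by (auto simp: sum.reindex[OF p_inj])
    qed simp
    with q have "M.V.independent (insert q (p ` {..d}))" by (simp add: M.V.independent_insert)
    moreover have "insert q (p ` {..d}) \<subseteq> M.V.span (monom 1 ` {..d})"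
    proof
      fix r assume "r \<in> insert q (p ` {..d})"
      then have "r = (\<Sum>i\<le>d. smult (coeff r i) (monom 1 i))"
        using p(1) that by (intro poly_as_sum_Vd) auto
      also have "\<dots> \<in> M.V.span (monom 1 ` {..d})"
        by (intro M.V.span_sum M.V.span_scale M.V.span_base) simp
      finally show "r \<in> M.V.span (monom 1 ` {..d})" .
    qed
    ultimately have "card (insert q (p ` {..d})) \<le> card (monom (1::'a) ` {..d})"
      using M.V.independent_span_bound by blast
    also have "\<dots> \<le> Suc d" using card_image_le[of "{..d}" "monom (1::'a)"] by simp
    finally have "card (insert q (p ` {..d})) \<le> Suc d" .
    moreover have "q \<notin> p ` {..d}" using q M.V.span_base[of q "p ` {..d}"] by metis
    ultimately show False using card_image[OF p_inj] by simp
  qed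
  have expand: "\<exists>b. q = (\<Sum>i\<le>d. smult (b i) (p i))" if q: "q \<in> Vd d" for q
  proof -
    obtain u where "q = (\<Sum>x\<in>p ` {..d}. smult (u x) x)"
      using span[OF q] by (auto simp: M.V.span_finite)
    then show ?thesis by (auto simp: sum.reindex[OF p_inj])
  qed
  \<comment> \<open>Coefficients of \<open>Vd_act d A q\<close> and \<open>smult s q\<close> are
    compared in the eigenbasis.\<close>
  have coords: "b i = 0 \<or> ?c i = s"
    if "Vd_act d A q = smult s q" "q = (\<Sum>i\<le>d. smult (b i) (p i))" "i \<le> d" for q s b i
  proof -
    have "Vd_act d A q = (\<Sum>i\<le>d. smult (b i * ?c i) (p i))"
      unfolding that(2) Vd_act_sum by (intro sum.cong) (simp_all add: Vd_act_smult p)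
    then have "(\<Sum>i\<le>d. smult (b i * (?c i - s)) (p i)) = Vd_act d A q - smult s q"
      by (simp add: that(2) M.V.scale_sum_right sum_subtractf[symmetric] smult_diff_left[symmetric]
          right_diff_distrib mult.commute)
    then show ?thesis using zero[of "\<lambda>i. b i * (?c i - s)"] that by simp
  qed
  have "eigenvalues smult (Vd d) (Vd_act d A) = ?c ` {..d}"
  proof (intro equalityI subsetI)
    fix s assume "s \<in> eigenvalues smult (Vd d) (Vd_act d A)"
    then obtain q where q: "q \<in> Vd d" "q \<noteq> 0" "Vd_act d A q = smult s q"
      by (auto simp: eigenvalues_def)
    obtain b where b: "q = (\<Sum>i\<le>d. smult (b i) (p i))" using expand q by blast
    with q(2) obtain i where "i \<le> d" "b i \<noteq> 0"
      by (metis (no_types, lifting) atMost_iff smult_0_left sum.neutral)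
    then show "s \<in> ?c ` {..d}" using coords[OF q(3) b] by auto
  qed (use p in \<open>auto simp: eigenvalues_def\<close>)
  \<comment> \<open>Eigenvalues run downwards in \<open>has_diameter\<close> and upwards in
    \<open>has_shape\<close>; \<open>n\<close> and \<open>d - n\<close> are exchanged.\<close>
  also have "\<dots> = {of_nat d - 2 * of_nat n |n. n \<le> d}"
  proof -
    have "of_nat d - 2 * of_nat n = ?c (d - n)" if "n \<le> d" for n
      using that by (simp add: of_nat_diff)
    moreover have "?c n = of_nat d - 2 * of_nat (d - n)" if "n \<le> d" for n
      using that by (simp add: of_nat_diff)
    ultimately show ?thesis by (fastforce simp: image_iff)
  qed
  finally show ?eigenvalues .
  show "?eigenspace n" if "n \<le> d"
  proof (intro exI conjI equalityI subsetI)
    fix q assume "q \<in> eigenspace smult (Vd d) (Vd_act d A) (?c n)"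
    then have q: "q \<in> Vd d" "Vd_act d A q = smult (?c n) q" by (auto simp: eigenspace_def)
    obtain b where b: "q = (\<Sum>i\<le>d. smult (b i) (p i))" using expand q by blast
    have "q = (\<Sum>i\<le>d. if i = n then smult (b n) (p n) else 0)"
      unfolding b using coords[OF q(2) b] by (intro sum.cong) auto
    then show "q \<in> range (\<lambda>c. smult c (p n))" using that by auto
  qed (use p that M.V.subspace_scale[OF M.subspace] in
      \<open>auto simp: eigenspace_def M.act_scale_right mult.commute\<close>)
qed

text \<open>The isomorphism \<open>T\<close> preserves and reflects eigenvectors, so the eigenspace
  line through \<open>p\<close> pulls back to the line through its preimage
  \<open>v\<close>.\<close>

lemma has_shape_evaluation_module:
  fixes scale :: "'a::field_char_0 \<Rightarrow> 'v::ab_group_add \<Rightarrow> 'v"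
  assumes "tetra_module scale V act" and a: "a \<noteq> 0" "a \<noteq> 1"
    and iso: "module_iso scale V act smult (Vd d) (evaluation_act d a)"
  shows "has_shape scale V act (replicate (d + 1) 1)"
proof -
  interpret lie_module tscale tbracket scale V act by fact
  obtain T where T: "bij_betw T V (Vd d)" "\<And>u v. u \<in> V \<Longrightarrow> v \<in> V \<Longrightarrow> T (u + v) = T u + T v"
    "\<And>c v. v \<in> V \<Longrightarrow> T (scale c v) = smult c (T v)"
    "\<And>x v. v \<in> V \<Longrightarrow> T (act x v) = Vd_act d (EV a x) (T v)"
    using iso by (auto simp: module_iso_def evaluation_act_def)
  have T_eq: "T u = T v \<longleftrightarrow> u = v" if "u \<in> V" "v \<in> V" for u v
    using T(1) that by (auto simp: bij_betw_def inj_on_def)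
  have T_zero: "T v = 0 \<longleftrightarrow> v = 0" if "v \<in> V" for v
    using T_eq[OF that V.subspace_0[OF subspace]] T(3)[OF that, of 0] by auto
  have eigen: "act x v = scale c v \<longleftrightarrow> Vd_act d (EV a x) (T v) = smult c (T v)" if "v \<in> V" for x c v
    using T_eq[OF act_closed V.subspace_scale, OF that subspace that, of x c] T(3,4) that by simp
  have image: "Vd d = T ` V" using T(1) by (simp add: bij_betw_def)
  have "eigenvalues scale V (act x) = eigenvalues smult (Vd d) (Vd_act d (EV a x))" for x
    by (simp add: eigenvalues_def image eigen T_zero)
  then have "has_diameter scale V act d"
    by (simp add: has_diameter_def Vd_eigenspace(1)[OF EV_gen_det[OF a]])
  moreover have "V.dim (eigenspace scale V (act (tgen i j)) (2 * of_nat n - of_nat d)) = 1"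
    (is "V.dim ?E = 1") if ijn: "i \<noteq> j" "n \<le> d" for i j n
  proof -
    let ?A = "EV a (tgen i j)" and ?c = "2 * of_nat n - of_nat d :: 'a"
    obtain p where p: "p \<noteq> 0" "eigenspace smult (Vd d) (Vd_act d ?A) ?c = range (\<lambda>c. smult c p)"
      using Vd_eigenspace(2)[OF EV_gen_det[OF a ijn(1)] ijn(2)] by blast
    then have "p \<in> eigenspace smult (Vd d) (Vd_act d ?A) ?c" by (metis rangeI smult_1_left)
    then obtain v where v: "v \<in> V" "T v = p" using image by (auto simp: eigenspace_def)
    have "w \<in> ?E \<longleftrightarrow> w \<in> range (\<lambda>c. scale c v)" for w
    proof
      assume w: "w \<in> ?E"
      then have "T w \<in> eigenspace smult (Vd d) (Vd_act d ?A) ?c"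
        using image eigen by (auto simp: eigenspace_def)
      then obtain c where "T w = smult c p" using p by auto
      then have "w = scale c v"
        using w v T(3) T_eq[of w "scale c v"] V.subspace_scale[OF subspace]
        by (simp add: eigenspace_def)
      then show "w \<in> range (\<lambda>c. scale c v)" by blast
    next
      assume "w \<in> range (\<lambda>c. scale c v)"
      then obtain c where c: "w = scale c v" by blast
      then have "w \<in> V" "T w = smult c p" using v T(3) V.subspace_scale[OF subspace] by auto
      then have "T w \<in> eigenspace smult (Vd d) (Vd_act d ?A) ?c" using p by auto
      then show "w \<in> ?E" using eigen \<open>w \<in> V\<close> by (auto simp: eigenspace_def)
    qed
    then have E: "?E = range (\<lambda>c. scale c v)" by blast
    then have "V.subspace ?E" by (metis V.span_singleton V.subspace_span)
    moreover have "v \<noteq> 0" using v p T_zero by auto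
    ultimately show ?thesis using E V.dim_eq_1_iff by blast
  qed
  ultimately show ?thesis by (auto simp: has_shape_def simp del: replicate_Suc)
qed

section \<open>Diagonalizability on irreducible modules\<close>

locale tetrahedron_module = lie_module tscale tbracket scale V act
  for scale :: "'a::field_char_0 \<Rightarrow> 'v::ab_group_add \<Rightarrow> 'v" and V and act
begin

abbreviation X :: "4 \<Rightarrow> 4 \<Rightarrow> 'v \<Rightarrow> 'v" where "X i j \<equiv> act (tgen i j)"

abbreviation E :: "4 \<Rightarrow> 4 \<Rightarrow> 'a \<Rightarrow> 'v set" where "E i j \<equiv> eigenspace scale V (X i j)"

lemmas closed [simp, intro] = act_closed V.subspace_add[OF subspace] V.subspace_diff[OF subspace]
  V.subspace_scale[OF subspace] V.subspace_0[OF subspace] V.subspace_neg[OF subspace]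

lemma act_zero_right [simp]: "act u 0 = 0"
  using act_scale_right[of 0 u 0] by simp

lemma act_neg_right: "v \<in> V \<Longrightarrow> act u (- v) = - act u v"
  using act_scale_right[of v u "- 1"] by simp

lemma act_diff_right: "v \<in> V \<Longrightarrow> w \<in> V \<Longrightarrow> act u (v - w) = act u v - act u w"
  using act_add_right[of v "- w" u] by (simp add: act_neg_right)

lemma act_zero_left [simp]: "v \<in> V \<Longrightarrow> act 0 v = 0"
  using act_add_left[of v 0 0] by simp

lemma act_neg_left: "v \<in> V \<Longrightarrow> act (- u) v = - act u v"
  using act_add_left[of v u "- u"] by (simp add: eq_neg_iff_add_eq_0 add.commute)

lemma X_skew: "v \<in> V \<Longrightarrow> X j i v = - X i j v"
  using act_add_left[of v "tgen i j" "tgen j i"] tgen_relations(1)[of i, where 'a='a]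
    tgen_relations(2)[of i j, where 'a='a]
  by (cases "i = j") (simp_all add: eq_neg_iff_add_eq_0 add.commute)

lemma X_bracket:
  "distinct [i, j, k] \<Longrightarrow> v \<in> V \<Longrightarrow>
    X i j (X j k v) = X j k (X i j v) + scale 2 (X i j v) + scale 2 (X j k v)"
  using act_bracket[of v "tgen i j" "tgen j k"] tgen_relations(3)[of i j k, where 'a='a]
  by (simp add: act_add_left act_scale_left algebra_simps)

text \<open>The elements that preserve \<open>W\<close> form a Lie subalgebra, and this one contains
  the generators.\<close>

lemma invariant_by_generators:
  assumes W: "V.subspace W" "W \<subseteq> V" and gen: "\<And>i j w. w \<in> W \<Longrightarrow> X i j w \<in> W" and "w \<in> W"
  shows "act u w \<in> W"
proof -
  have "\<forall>w\<in>W. act u w \<in> W"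
  proof (induction u rule: tetra_induct)
    case (bracket u v)
    then show ?case using W(2) by (metis act_bracket subsetD V.subspace_diff[OF W(1)])
  qed (use W gen in \<open>auto simp: subset_iff act_add_left act_scale_left V.subspace_0
      V.subspace_add V.subspace_scale\<close>)
  then show ?thesis using \<open>w \<in> W\<close> by blast
qed

lemma subspace_E: "V.subspace (E i j c)"
  by (rule V.subspaceI)
    (auto simp: eigenspace_def act_add_right act_scale_right V.scale_right_distrib mult.commute)

text \<open>By relation (ii), \<open>ad x_ij\<close> multiplies \<open>x_ij + x_jk\<close> by 2, and
  on \<open>E i j c\<close> this sum acts as \<open>X j k\<close> plus the scalar
  \<open>c\<close>.\<close>

lemma raising:
  assumes "distinct [i, j, k]" "v \<in> E i j c"
  shows "X j k v + scale c v \<in> E i j (c + 2)"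
proof -
  have "v \<in> V" "X i j v = scale c v" using assms by (auto simp: eigenspace_def)
  then show ?thesis using X_bracket[of i j k v] assms(1)
    by (simp add: eigenspace_def act_add_right act_scale_right V.scale_right_distrib
        V.scale_left_distrib algebra_simps)
qed

text \<open>Here \<open>ad x_ij\<close> multiplies \<open>x_ki + x_ij\<close> by -2.\<close>

lemma lowering:
  assumes "distinct [i, j, k]" "v \<in> E i j c"
  shows "X k i v + scale c v \<in> E i j (c - 2)"
proof -
  have "v \<in> V" "X i j v = scale c v" using assms by (auto simp: eigenspace_def)
  then show ?thesis using X_bracket[of k i j v] assms(1)
    by (auto simp add: eigenspace_def act_add_right act_scale_right V.scale_right_distrib
        V.scale_left_distrib V.scale_left_diff_distrib algebra_simps)
qed

text \<open>The relation (iii) says that \<open>ad x\<^sub>i\<^sub>j\<close> has eigenvalues \<open>0, 2, -2\<close> on \<open>x\<^sub>k\<^sub>l\<close>.\<close>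

lemma opposite:
  assumes "distinct [i, j, k, l]" "v \<in> E i j c"
  shows "\<exists>p\<in>E i j c. \<exists>q\<in>E i j (c + 2). \<exists>r\<in>E i j (c - 2). X k l v = p + q + r"
proof -
  have v: "v \<in> V" "X i j v = scale c v" using assms by (auto simp: eigenspace_def)
  let ?b = "X k l v"
  let ?S = "\<lambda>w. X i j w - scale c w"
  have S: "w \<in> V \<Longrightarrow> ?S w \<in> V" for w by simp
  \<comment> \<open>On the eigenvector \<open>v\<close>, bracketing with \<open>x_ij\<close> becomes
    the operator \<open>?S\<close>, so relation (iii) turns into a cubic equation for
    \<open>?S\<close>.\<close>
  have br: "act (tbracket (tgen i j) u) v = ?S (act u v)" for u
    using v by (simp add: act_bracket act_scale_right)
  have "act (tbracket (tgen i j) (tbracket (tgen i j) (tbracket (tgen i j) (tgen k l)))) v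
      = act (tscale 4 (tbracket (tgen i j) (tgen k l))) v"
    using tgen_relations(4)[OF assms(1), where 'a='a] by simp
  then have S3: "?S (?S (?S ?b)) = scale 4 (?S ?b)"
    using v(1) by (simp add: br act_scale_left)
  have S_add: "?S (x + y) = ?S x + ?S y" if "x \<in> V" "y \<in> V" for x y
    using that by (simp add: act_add_right V.scale_right_distrib)
  have S_scale: "?S (scale t x) = scale t (?S x)" if "x \<in> V" for x t
    using that by (simp add: act_scale_right V.scale_right_diff_distrib mult.commute)
  have E: "w \<in> E i j (c + t)" if "w \<in> V" "?S w = scale t w" for w t
    using that by (simp add: eigenspace_def V.scale_left_distrib diff_eq_eq add.commute)
  \<comment> \<open>Since \<open>?S (?S - 2) (?S + 2)\<close> kills \<open>?b\<close>, Lagrange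
    interpolation at 0, 2, -2 gives the three components as combinations of \<open>?b\<close>,
    \<open>s\<close> and \<open>t\<close>.\<close>
  define s where "s = ?S ?b"
  define t where "t = ?S s"
  have V: "?b \<in> V" "s \<in> V" "t \<in> V" using v by (simp_all add: s_def t_def)
  have St: "?S t = scale 4 s" using S3 by (simp add: s_def t_def)
  have "?b + scale (- 1 / 4) t \<in> E i j (c + 0)"
    using V by (intro E) (simp_all only: S_add S_scale closed St s_def[symmetric], simp)
  moreover have "scale (1 / 8) t + scale (1 / 4) s \<in> E i j (c + 2)"
    using V by (intro E) (simp_all only: S_add S_scale closed St t_def[symmetric],
      simp add: V.scale_right_distrib)
  moreover have "scale (1 / 8) t + scale (- 1 / 4) s \<in> E i j (c + (- 2))"
    using V by (intro E) (simp_all only: S_add S_scale closed St t_def[symmetric],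
      simp add: V.scale_right_diff_distrib)
  moreover have "?b = ?b + scale (- 1 / 4) t + (scale (1 / 8) t + scale (1 / 4) s)
      + (scale (1 / 8) t + scale (- 1 / 4) s)"
    by (simp add: algebra_simps V.scale_left_distrib[symmetric])
  ultimately show ?thesis by (metis add.right_neutral diff_conv_add_uminus)
qed

text \<open>By irreducibility it suffices that the sum of the eigenspaces is invariant.\<close>

lemma diagonalizable:
  assumes "irreducible_action scale V act" "i \<noteq> j" "E i j c \<noteq> {0}"
  shows "V = V.span (\<Union>c. E i j c)" (is "V = ?W")
proof -
  have EV: "E i j c \<subseteq> V" for c by (auto simp: eigenspace_def)
  then have W: "V.subspace ?W" "?W \<subseteq> V"
    using V.span_minimal[of "\<Union>c. E i j c" V] subspace by auto
  have E_W: "v \<in> E i j c \<Longrightarrow> v \<in> ?W" for v c by (auto intro: V.span_base)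
  have eigen: "X k l v \<in> ?W" if v: "v \<in> E i j c" for k l v c
  proof -
    have vV: "v \<in> V" "X i j v = scale c v" using v by (auto simp: eigenspace_def)
    \<comment> \<open>A generator sharing one index with \<open>x_ij\<close> moves \<open>v\<close>
      to a neighbouring eigenspace, up to a multiple of \<open>v\<close>; only the generators on the
      two opposite indices call for relation (iii).\<close>
    have *: "X j m v \<in> ?W \<and> X m j v \<in> ?W" if "distinct [i, j, m]" for m
    proof -
      have "X j m v = X j m v + scale c v - scale c v" by simp
      also have "\<dots> \<in> ?W"
        using raising[OF that v] by (intro V.span_diff V.span_scale) (auto intro: E_W v)
      finally show ?thesis using X_skew[OF vV(1), of m j] by (simp add: V.span_neg)
    qed
    have **: "X i m v \<in> ?W \<and> X m i v \<in> ?W" if "distinct [i, j, m]" for m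
    proof -
      have "X m i v = X m i v + scale c v - scale c v" by simp
      also have "\<dots> \<in> ?W"
        using lowering[OF that v] by (intro V.span_diff V.span_scale) (auto intro: E_W v)
      finally show ?thesis using X_skew[OF vV(1), of i m] by (simp add: V.span_neg)
    qed
    have ***: "X i j v \<in> ?W \<and> X j i v \<in> ?W"
      using X_skew[OF vV(1), of j i] E_W[OF v] vV(2) by (simp add: V.span_neg V.span_scale)
    consider "k = l" | "k = i" "l = j" | "k = j" "l = i" | "distinct [i, j, k, l]"
      | "k = i" "distinct [i, j, l]" | "k = j" "distinct [i, j, l]"
      | "l = i" "distinct [i, j, k]" | "l = j" "distinct [i, j, k]"
      using \<open>i \<noteq> j\<close> by auto
    then show ?thesis
    proof cases
      case 1
      then show ?thesis using vV(1) by (simp add: tgen_relations(1) V.span_zero)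
    next
      case 4
      from opposite[OF this v] show ?thesis by (metis E_W V.span_add)
    qed (use * ** *** in auto)
  qed
  have "w \<in> V \<and> X k l w \<in> ?W" if "w \<in> ?W" for k l w
    using that
  proof (induction rule: V.span_induct_alt)
    case base
    show ?case by (simp add: V.span_zero)
  next
    case (step b x y)
    then have "x \<in> V" using EV by auto
    with step eigen show ?case
      by (auto simp: act_add_right act_scale_right intro!: V.span_add V.span_scale)
  qed
  then have "\<forall>x. \<forall>w\<in>?W. act x w \<in> ?W" using invariant_by_generators[OF W] by blast
  then have "?W = {0} \<or> ?W = V" using assms(1) W by (auto simp: irreducible_action_def)
  moreover have "?W \<noteq> {0}" using E_W assms(3) V.subspace_0[OF subspace_E] by blast
  ultimately show ?thesis by simp
qed


text \<open>For \<open>j \<in> {0, 2}\<close> the elements \<open>raise j\<close>, \<open>lower j\<close>, \<open>x\<^sub>3\<^sub>1\<close> form an \<open>sl\<^sub>2\<close>-triple \<open>e, f, h\<close>; \<open>EV a\<close> maps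
  the triple for \<open>j = 2\<close> to the standard one.\<close>

definition raise :: "4 \<Rightarrow> 'a tetra" where
  "raise j = tscale (1 / 2) (tgen 1 j + tgen 3 1)"

definition lower :: "4 \<Rightarrow> 'a tetra" where
  "lower j = - tscale (1 / 2) (tgen j 3 + tgen 3 1)"

lemma X_1_raise: "v \<in> V \<Longrightarrow> X 1 j v = scale 2 (act (raise j) v) - X 3 1 v"
  by (simp add: raise_def act_scale_left act_add_left)

lemma X_3_lower: "v \<in> V \<Longrightarrow> X j 3 v = scale (- 2) (act (lower j) v) - X 3 1 v"
  by (simp add: lower_def act_neg_left act_scale_left act_add_left)

lemma raise_mem:
  assumes "j \<noteq> 1" "j \<noteq> 3" "v \<in> E 3 1 c"
  shows "act (raise j) v \<in> E 3 1 (c + 2)"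
proof -
  have "v \<in> V" "X 3 1 v = scale c v" using assms(3) by (auto simp: eigenspace_def)
  then show ?thesis
    using V.subspace_scale[OF subspace_E raising[of 3 1 j v c], of "1 / 2"] assms
    by (simp add: raise_def act_scale_left act_add_left)
qed

lemma lower_mem:
  assumes "j \<noteq> 1" "j \<noteq> 3" "v \<in> E 3 1 c"
  shows "act (lower j) v \<in> E 3 1 (c - 2)"
proof -
  have "v \<in> V" "X 3 1 v = scale c v" using assms(3) by (auto simp: eigenspace_def)
  then show ?thesis
    using V.subspace_scale[OF subspace_E lowering[of 3 1 j v c], of "- 1 / 2"] assms
    by (simp add: lower_def act_neg_left act_scale_left act_add_left)
qed


lemma scale_2_4: "scale 2 v = v + v" "scale 4 v = v + v + (v + v)"
  using V.scale_left_distrib[of 1 1 v] V.scale_left_distrib[of 2 2 v] by simp_all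

text \<open>The three relations (ii) on the indices 1, \<open>j\<close>, 3 add up to
  \<open>[R, L] = -4 x_31\<close>; the factors 1/2 and -1/2 turn this into
  \<open>[e, f] = h\<close>.\<close>

lemma raise_lower:
  assumes "j \<noteq> 1" "j \<noteq> 3" "v \<in> V"
  shows "act (raise j) (act (lower j) v) = act (lower j) (act (raise j) v) + X 3 1 v"
proof -
  define R where "R = (\<lambda>v. X 1 j v + X 3 1 v)"
  define L where "L = (\<lambda>v. X j 3 v + X 3 1 v)"
  have R: "act (raise j) w = scale (1 / 2) (R w)" if "w \<in> V" for w
    using that by (simp add: raise_def R_def act_scale_left act_add_left)
  have L: "act (lower j) w = - scale (1 / 2) (L w)" if "w \<in> V" for w
    using that by (simp add: lower_def L_def act_neg_left act_scale_left act_add_left)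
  have RL: "R w \<in> V" "L w \<in> V" if "w \<in> V" for w using that by (simp_all add: R_def L_def)
  have Rs: "R (- scale t w) = - scale t (R w)" if "w \<in> V" for t w
    using that by (simp add: R_def act_neg_right act_scale_right V.scale_right_distrib)
  have Ls: "L (scale t w) = scale t (L w)" if "w \<in> V" for t w
    using that by (simp add: L_def act_scale_right V.scale_right_distrib)
  have "R (L v) = L (R v) - scale 4 (X 3 1 v)"
    using assms X_bracket[of 1 j 3 v] X_bracket[of j 3 1 v] X_bracket[of 3 1 j v]
    by (simp add: R_def L_def act_add_right) (simp add: scale_2_4)
  then have "scale (1 / 4) (R (L v)) = scale (1 / 4) (L (R v)) - X 3 1 v"
    by (simp add: V.scale_right_diff_distrib)
  then show ?thesis using \<open>v \<in> V\<close> by (simp add: R L RL Rs Ls)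
qed

text \<open>The brackets \<open>[x_i3, x_j3] = -2 x_i3 + 2 x_j3\<close>,
  \<open>[x_i3, x_31] = 2 x_i3 + 2 x_31\<close> and \<open>[x_31, x_j3] = -2 x_31 - 2 x_j3\<close>
  add up to 0.\<close>

lemma lower_commute:
  assumes "i \<noteq> j" "i \<noteq> 1" "i \<noteq> 3" "j \<noteq> 1" "j \<noteq> 3" "v \<in> V"
  shows "act (lower i) (act (lower j) v) = act (lower j) (act (lower i) v)"
proof -
  define L where "L = (\<lambda>j v. X j 3 v + X 3 1 v)"
  have L: "act (lower j) w = - scale (1 / 2) (L j w)" if "w \<in> V" for j w
    using that by (simp add: lower_def L_def act_neg_left act_scale_left act_add_left)
  have LV: "L j w \<in> V" if "w \<in> V" for j w using that by (simp_all add: L_def)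
  have Ls: "L j (- scale t w) = - scale t (L j w)" if "w \<in> V" for t w j
    using that by (simp add: L_def act_neg_right act_scale_right V.scale_right_distrib)
  have "L i (L j v) = L j (L i v)"
    using assms X_bracket[of i 3 j v] X_bracket[of i 3 1 v] X_bracket[of j 3 1 v]
    by (simp add: L_def act_add_right scale_2_4 X_skew[of _ 3 j] act_neg_right algebra_simps)
  then show ?thesis using \<open>v \<in> V\<close> by (simp add: L LV Ls)
qed


lemma E_eq_0: "E i j c = {0}" if "c \<notin> eigenvalues scale V (X i j)"
  using that by (auto simp: eigenspace_def eigenvalues_def)

lemma E_neq_0: "E i j c \<noteq> {0}" if "c \<in> eigenvalues scale V (X i j)"
  using that by (auto simp: eigenspace_def eigenvalues_def)

text \<open>Each generator is diagonalizable with 0 as its only eigenvalue, hence acts as 0. This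
  excludes \<open>d = 0\<close> for nontrivial modules.\<close>

lemma trivial_if_diameter_0:
  assumes "irreducible_action scale V act" and diam: "has_diameter scale V act 0"
    and "V.dim (E 3 1 0) = 1"
  shows "trivial_action scale V act"
proof -
  have ev: "eigenvalues scale V (X i j) = {0}" if "i \<noteq> j" for i j
    using diam that by (simp add: has_diameter_def)
  have V: "V = E i j 0" if "i \<noteq> j" for i j
  proof -
    have "V = V.span (\<Union>c. E i j c)"
      using that by (intro diagonalizable[OF assms(1), of _ _ 0] E_neq_0) (simp_all add: ev)
    also have "\<dots> \<subseteq> E i j 0"
    proof (rule V.span_minimal)
      show "(\<Union>c. E i j c) \<subseteq> E i j 0"
      proof (intro UN_least)
        fix c
        show "E i j c \<subseteq> E i j 0"
          using E_eq_0[of c i j] ev[OF that] V.subspace_0[OF subspace_E[of i j 0]]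
          by (cases "c = 0") auto
      qed
    qed (rule subspace_E)
    finally show ?thesis by (auto simp: eigenspace_def)
  qed
  have X: "X i j v = 0" if "v \<in> V" for i j v
    using V[of i j] that by (cases "i = j") (auto simp: eigenspace_def tgen_relations(1))
  have "\<forall>v\<in>V. act u v = 0" for u
    by (induction u rule: tetra_induct)
      (simp_all add: X act_add_left act_scale_left act_bracket)
  moreover have "V.dim V = 1" using V[of 3 1] assms(3) by simp
  ultimately show ?thesis by (simp add: trivial_action_def)
qed

end

section \<open>Modules of shape \<open>(1, \<dots>, 1)\<close>\<close>

locale thin_tetrahedron_module = tetrahedron_module scale V act
  for scale :: "'a::field_char_0 \<Rightarrow> 'v::ab_group_add \<Rightarrow> 'v" and V and act +
  fixes d :: nat
  assumes irreducible: "irreducible_action scale V act"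
    and diameter: "has_diameter scale V act d"
    and dim_E: "n \<le> d \<Longrightarrow> V.dim (E 3 1 (2 * of_nat n - of_nat d)) = 1"
    and d_pos: "1 \<le> d"
begin

lemma eigenvalues_31: "eigenvalues scale V (X 3 1) = {of_nat d - 2 * of_nat n |n. n \<le> d}"
  using diameter by (simp add: has_diameter_def)

lemma E_outside: "E 3 1 c = {0}" if "\<And>n. n \<le> d \<Longrightarrow> c \<noteq> of_nat d - 2 * of_nat n"
  using that by (intro E_eq_0) (auto simp: eigenvalues_31)

lemma E_line:
  assumes "n \<le> d" "v \<in> E 3 1 (of_nat d - 2 * of_nat n)" "v \<noteq> 0"
  shows "E 3 1 (of_nat d - 2 * of_nat n) = range (\<lambda>c. scale c v)"
proof -
  \<comment> \<open>Weights are counted downwards from \<open>d\<close> here, but upwards from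
    \<open>- d\<close> in \<open>dim_E\<close>.\<close>
  have "2 * of_nat (d - n) - of_nat d = (of_nat d - 2 * of_nat n :: 'a)"
    using assms(1) by (simp add: of_nat_diff)
  then obtain w where w: "w \<noteq> 0" "E 3 1 (of_nat d - 2 * of_nat n) = range (\<lambda>c. scale c w)"
    using dim_E[of "d - n"] V.dim_eq_1_iff[OF subspace_E] by auto
  then obtain c where c: "v = scale c w" using assms(2) by auto
  with assms(3) have "c \<noteq> 0" by auto
  then have "scale t w = scale (t / c) v" for t by (simp add: c)
  then have "range (\<lambda>t. scale t w) \<subseteq> range (\<lambda>t. scale t v)" by blast
  moreover have "scale t v = scale (t * c) w" for t by (simp add: c)
  then have "range (\<lambda>t. scale t v) \<subseteq> range (\<lambda>t. scale t w)" by blast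
  ultimately show ?thesis unfolding w(2) by simp
qed

section \<open>A weight basis generated by a highest weight vector\<close>

definition v0 :: 'v where "v0 = (SOME v. v \<in> E 3 1 (of_nat d) \<and> v \<noteq> 0)"

lemma v0: "v0 \<in> E 3 1 (of_nat d)" "v0 \<noteq> 0"
proof -
  have "of_nat d \<in> eigenvalues scale V (X 3 1)"
    unfolding eigenvalues_31 by (auto intro!: exI[of _ 0])
  then have "\<exists>v. v \<in> E 3 1 (of_nat d) \<and> v \<noteq> 0"
    by (auto simp: eigenspace_def eigenvalues_def)
  from someI_ex[OF this] show "v0 \<in> E 3 1 (of_nat d)" "v0 \<noteq> 0" by (auto simp: v0_def)
qed

lemma v0_V [simp]: "v0 \<in> V"
  using v0 by (simp add: eigenspace_def)

text \<open>The images of the monomials \<open>t\<^sup>n\<close> under the isomorphism from \<open>V\<^sub>d\<close>.\<close>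

primrec w :: "nat \<Rightarrow> 'v" where
  "w 0 = v0"
| "w (Suc n) = scale (1 / (of_nat d - of_nat n)) (act (lower 2) (w n))"

lemma w_E: "w n \<in> E 3 1 (of_nat d - 2 * of_nat n)"
proof (induction n)
  case (Suc n)
  show ?case
    using V.subspace_scale[OF subspace_E lower_mem[OF _ _ Suc, of 2]] by (simp add: algebra_simps)
qed (simp add: v0)

lemma w_V [simp]: "w n \<in> V"
  using w_E[of n] by (simp add: eigenspace_def)

lemma X_w: "X 3 1 (w n) = scale (of_nat d - 2 * of_nat n) (w n)"
  using w_E[of n] by (simp add: eigenspace_def)

text \<open>For \<open>n < d\<close> this is the recursion for \<open>w\<close>. At
  \<open>n = d\<close> the right side is 0, and so is the left side, because its weight
  \<open>- d - 2\<close> is not an eigenvalue of \<open>x_31\<close>.\<close>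

lemma lower_w:
  assumes "n \<le> d"
  shows "act (lower 2) (w n) = scale (of_nat d - of_nat n) (w (Suc n))"
proof (cases "n = d")
  case True
  have "(of_nat d - 2 * of_nat d - 2 :: 'a) \<noteq> of_nat d - 2 * of_nat m" if "m \<le> d" for m
  proof
    assume "of_nat d - 2 * of_nat d - 2 = (of_nat d - 2 * of_nat m :: 'a)"
    then have "(2 * of_nat m :: 'a) = 2 * of_nat (d + 1)" by (simp add: algebra_simps)
    then have "m = d + 1" by (simp only: mult_cancel_left of_nat_eq_iff) simp
    with that show False by simp
  qed
  then show ?thesis using True lower_mem[OF _ _ w_E[of d], of 2] E_outside by auto
qed (use assms in simp)

text \<open>The image has weight \<open>d + 2\<close>, which is not an eigenvalue; so
  \<open>w 0\<close> is a highest weight vector for both triples.\<close>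

lemma raise_w0:
  assumes "j \<noteq> 1" "j \<noteq> 3"
  shows "act (raise j) (w 0) = 0"
proof -
  have "(of_nat d + 2 :: 'a) \<noteq> of_nat d - 2 * of_nat m" for m
  proof
    assume "of_nat d + 2 = (of_nat d - 2 * of_nat m :: 'a)"
    then have "(2 * of_nat (m + 1) :: 'a) = 0" by (simp add: algebra_simps)
    then show False by (simp only: mult_eq_0_iff of_nat_eq_0_iff) simp
  qed
  then show ?thesis using raise_mem[OF assms w_E[of 0]] E_outside by auto
qed

lemma raise_w_Suc: "n < d \<Longrightarrow> act (raise 2) (w (Suc n)) = scale (of_nat (Suc n)) (w n)"
proof (induction n)
  case 0
  then show ?case using raise_lower[of 2 "w 0"] raise_w0[of 2]
    by (simp add: act_scale_right X_w[of 0, simplified])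
next
  case (Suc n)
  let ?c = "of_nat d - of_nat (Suc n) :: 'a"
  have "?c \<noteq> 0" using Suc.prems by (metis eq_iff_diff_eq_0 nat_neq_iff of_nat_eq_iff)
  have "act (raise 2) (act (lower 2) (w (Suc n))) =
      act (lower 2) (scale (of_nat (Suc n)) (w n)) + X 3 1 (w (Suc n))"
    using raise_lower[of 2 "w (Suc n)"] Suc by simp
  \<comment> \<open>The scalars satisfy
    \<open>(n + 1) (d - n) + (d - 2 (n + 1)) = (d - n - 1) (n + 2)\<close>, and \<open>?c\<close>
    can be cancelled as \<open>Suc n < d\<close>.\<close>
  also have "\<dots> = scale (?c * of_nat (Suc (Suc n))) (w (Suc n))"
    using Suc.prems unfolding X_w
    by (simp del: w.simps add: act_scale_right lower_w V.scale_left_distrib[symmetric])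
       (simp add: algebra_simps)
  finally show ?case using \<open>?c \<noteq> 0\<close> by 
    (simp only: w.simps(2)[of "Suc n"] act_scale_right act_closed w_V) simp
qed

text \<open>At \<open>n = 0\<close> the coefficient vanishes, so the truncated \<open>n - 1\<close>
  does no harm.\<close>

lemma raise_w: "n \<le> d \<Longrightarrow> act (raise 2) (w n) = scale (of_nat n) (w (n - 1))"
  using raise_w0[of 2] raise_w_Suc[of "n - 1"] by (cases n) (simp_all del: w.simps)

lemma w_neq_0: "n \<le> d \<Longrightarrow> w n \<noteq> 0"
proof (induction n)
  case (Suc n)
  then have "act (raise 2) (w (Suc n)) \<noteq> 0"
    using raise_w_Suc[of n] by (simp del: w.simps of_nat_Suc)
  then show ?case by (metis act_zero_right)
qed (simp add: v0)

text \<open>By \<open>diagonalizable\<close>, \<open>V\<close> is the sum of the eigenspaces of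
  \<open>x_31\<close>, and these are the lines through the \<open>w n\<close>.\<close>

lemma span_w: "V.span (w ` {..d}) = V"
proof
  show "V.span (w ` {..d}) \<subseteq> V" by (rule V.span_minimal) (auto simp: subspace)
  have "of_nat d \<in> eigenvalues scale V (X 3 1)"
    unfolding eigenvalues_31 by (auto intro!: exI[of _ 0])
  then have "V = V.span (\<Union>c. E 3 1 c)"
    by (intro diagonalizable[OF irreducible _ E_neq_0]) auto
  also have "\<dots> \<subseteq> V.span (w ` {..d})"
  proof (rule V.span_minimal)
    show "(\<Union>c. E 3 1 c) \<subseteq> V.span (w ` {..d})"
    proof (intro UN_least)
      fix c
      show "E 3 1 c \<subseteq> V.span (w ` {..d})"
      proof (cases "\<exists>n\<le>d. c = of_nat d - 2 * of_nat n")
        case True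
        then obtain n where n: "n \<le> d" "c = of_nat d - 2 * of_nat n" by blast
        then have "E 3 1 c = range (\<lambda>c. scale c (w n))" using E_line w_E w_neq_0 by simp
        then show ?thesis using n by (auto intro!: V.span_scale[OF V.span_base])
      next
        case False
        then show ?thesis using E_outside[of c] by (auto intro: V.span_zero)
      qed
    qed
  qed simp
  finally show "V \<subseteq> V.span (w ` {..d})" .
qed

lemma act_eqI:
  assumes "\<And>n. n \<le> d \<Longrightarrow> act u (w n) = act u' (w n)" and "v \<in> V"
  shows "act u v = act u' v"
proof -
  have "V.subspace {v \<in> V. act u v = act u' v}"
    by (rule V.subspaceI) (auto simp: act_add_right act_scale_right)
  then have "V.span (w ` {..d}) \<subseteq> {v \<in> V. act u v = act u' v}"
    using assms(1) by (intro V.span_minimal) auto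
  then show ?thesis using assms(2) span_w by auto
qed


section \<open>Comparison of the two \<open>sl2\<close>-triples and the evaluation parameter\<close>

text \<open>Both operators send \<open>w 0\<close> into the line through \<open>w 1\<close>, which
  fixes \<open>a\<close>; the divisor \<open>d\<close> comes from \<open>lower 2\<close> sending
  \<open>w 0\<close> to \<open>d\<close> times \<open>w 1\<close>. As they commute, the
  proportionality propagates along the powers of \<open>lower 2\<close> applied to
  \<open>w 0\<close>.\<close>

lemma lower_0_proportional:
  obtains a where "\<And>v. v \<in> V \<Longrightarrow> act (lower 0) v = scale a (act (lower 2) v)"
proof -
  have "act (lower 0) (w 0) \<in> E 3 1 (of_nat d - 2 * of_nat 1)"
    using lower_mem[OF _ _ w_E[of 0], of 0] by simp
  then obtain b where b: "act (lower 0) (w 0) = scale b (w 1)"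
    using E_line[OF d_pos w_E w_neq_0[OF d_pos]] by auto
  define a where "a = b / of_nat d"
  have *: "act (lower 0) (w n) = act (tscale a (lower 2)) (w n)" if "n \<le> d" for n
    using that
  proof (induction n)
    case 0
    then show ?case using b d_pos lower_w[of 0] by (simp add: a_def act_scale_left)
  next
    case (Suc n)
    then show ?case using lower_commute[of 0 2 "w n"]
      by (simp add: act_scale_left act_scale_right mult.commute)
  qed
  then have "act (lower 0) v = scale a (act (lower 2) v)" if "v \<in> V" for v
    using act_eqI[OF * that] that by (simp add: act_scale_left)
  then show ?thesis using that by blast
qed

text \<open>In the notation of the two triples, \<open>a [e', f] = [e', f'] = h = [e, f]\<close>, so
  \<open>a e' - e\<close> commutes with \<open>f\<close>. It kills \<open>w 0\<close>, hence every
  \<open>w n\<close>.\<close>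

lemma raise_0_proportional:
  assumes a: "\<And>v. v \<in> V \<Longrightarrow> act (lower 0) v = scale a (act (lower 2) v)" and "v \<in> V"
  shows "scale a (act (raise 0) v) = act (raise 2) v"
proof -
  have *: "act (tscale a (raise 0)) (w n) = act (raise 2) (w n)" if "n \<le> d" for n
    using that
  proof (induction n)
    case 0
    then show ?case using raise_w0[of 0] raise_w0[of 2] by (simp add: act_scale_left)
  next
    case (Suc n)
    let ?c = "of_nat d - of_nat n :: 'a"
    have c: "?c \<noteq> 0" using Suc.prems by (metis eq_iff_diff_eq_0 Suc_n_not_le_n of_nat_eq_iff)
    have IH: "scale a (act (raise 0) (w n)) = act (raise 2) (w n)"
      using Suc by (simp add: act_scale_left)
    have "scale a (act (raise 0) (act (lower 2) (w n))) = act (raise 0) (act (lower 0) (w n))"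
      by (simp add: a act_scale_right)
    also have "\<dots> = act (lower 2) (scale a (act (raise 0) (w n))) + X 3 1 (w n)"
      using raise_lower[of 0 "w n"] by (simp add: a act_scale_right)
    also have "\<dots> = act (raise 2) (act (lower 2) (w n))"
      unfolding IH using raise_lower[of 2 "w n"] by simp
    finally have "act (tscale a (raise 0)) (act (lower 2) (w n)) = act (raise 2) (act (lower 2) (w n))"
      by (simp add: act_scale_left)
    then show ?case by (simp add: act_scale_right)
  qed
  then show ?thesis using act_eqI[OF * assms(2)] assms(2) by (simp add: act_scale_left)
qed

text \<open>These are the values of \<open>EV a\<close> on the generators with index 0, now as
  operator identities on \<open>V\<close>.\<close>

lemma X_0:
  obtains a where "a \<noteq> 0" "a \<noteq> 1"
    "\<And>v. v \<in> V \<Longrightarrow> X 0 3 v = scale a (X 2 3 v) + scale (a - 1) (X 3 1 v)"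
    "\<And>v. v \<in> V \<Longrightarrow> X 0 1 v = scale (1 - inverse a) (X 3 1 v) - scale (inverse a) (X 1 2 v)"
    "\<And>v. v \<in> V \<Longrightarrow> X 0 2 v = scale (inverse (1 - a)) (X 1 2 v) + scale (a * inverse (1 - a)) (X 2 3 v)"
proof -
  obtain a where l: "\<And>v. v \<in> V \<Longrightarrow> act (lower 0) v = scale a (act (lower 2) v)"
    using lower_0_proportional by blast
  have r: "scale a (act (raise 0) v) = act (raise 2) v" if "v \<in> V" for v
    using l that by (rule raise_0_proportional)
  \<comment> \<open>Otherwise \<open>raise 2\<close> would vanish on \<open>V\<close>, but it sends
    \<open>w 1\<close> to \<open>w 0\<close>.\<close>
  have "a \<noteq> 0"
  proof
    assume "a = 0"
    then have "act (raise 2) (w 1) = 0" using r[of "w 1"] by (simp del: One_nat_def)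
    then show False using raise_w_Suc[of 0] d_pos v0 by simp
  qed
  have X03: "X 0 3 v = scale a (X 2 3 v) + scale (a - 1) (X 3 1 v)" if "v \<in> V" for v
    using that by (simp add: X_3_lower l V.scale_right_diff_distrib V.scale_left_diff_distrib mult.commute)
  have X01: "scale a (X 0 1 v) = scale (a - 1) (X 3 1 v) - X 1 2 v" if "v \<in> V" for v
    using that X_skew[of v 0 1] r[OF that, symmetric]
    by (simp add: X_1_raise V.scale_right_diff_distrib V.scale_left_diff_distrib mult.commute)
  have X02: "scale (a - 1) (X 0 2 v) = - scale a (X 2 3 v) - X 1 2 v" if "v \<in> V" for v
  proof -
    let ?p = "X 0 2 v"
    \<comment> \<open>No relation (ii) evaluates the bracket \<open>z\<close> of \<open>x_02\<close>
      with the opposite generator \<open>x_31\<close>. Expanding \<open>[x_02, x_03]\<close> by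
      \<open>X03\<close> and \<open>[x_02, x_01]\<close> by \<open>X01\<close> gives two values of
      \<open>(a - 1) z\<close>, and equating them eliminates it.\<close>
    define z where "z = X 0 2 (X 3 1 v) - X 3 1 ?p"
    have "X 0 2 (X 0 3 v) - X 0 3 ?p = scale 2 ?p - scale 2 (X 0 3 v)"
      using that X_bracket[of 3 0 2 v] by (simp add: X_skew[of _ 3 0] act_neg_right algebra_simps)
    then have "scale (a - 1) z + scale a (X 0 2 (X 2 3 v) - X 2 3 ?p)
        = scale 2 ?p - scale 2 (scale a (X 2 3 v) + scale (a - 1) (X 3 1 v))"
      using that by (simp add: X03 act_add_right act_scale_right z_def V.scale_right_diff_distrib)
        (simp add: algebra_simps)
    moreover have "X 0 2 (X 2 3 v) - X 2 3 ?p = scale 2 ?p + scale 2 (X 2 3 v)"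
      using that X_bracket[of 0 2 3 v] by simp
    ultimately have "scale (a - 1) z = scale 2 ?p - scale 2 (scale a (X 2 3 v) + scale (a - 1) (X 3 1 v))
        - scale a (scale 2 ?p + scale 2 (X 2 3 v))"
      by (simp add: eq_diff_eq)
    also have "\<dots> = scale (2 - 2 * a) ?p - scale (4 * a) (X 2 3 v) - scale (2 * (a - 1)) (X 3 1 v)"
      using V.scale_left_distrib[of "2 * a" "2 * a" "X 2 3 v"]
      by (simp add: V.scale_right_distrib V.scale_left_diff_distrib V.scale_right_diff_distrib mult.commute)
    finally have 1: "scale (a - 1) z = \<dots>" .
    have "X 0 2 (X 0 1 v) - X 0 1 ?p = scale 2 ?p - scale 2 (X 0 1 v)"
      using that X_bracket[of 1 0 2 v] by (simp add: X_skew[of _ 1 0] act_neg_right algebra_simps)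
    \<comment> \<open>Multiplying by \<open>a\<close> makes \<open>X01\<close> applicable, which
      describes \<open>a x_01\<close>.\<close>
    then have "scale a (X 0 2 (X 0 1 v) - X 0 1 ?p) = scale a (scale 2 ?p - scale 2 (X 0 1 v))"
      by simp
    then have "X 0 2 (scale a (X 0 1 v)) - scale a (X 0 1 ?p)
        = scale (2 * a) ?p - scale 2 (scale a (X 0 1 v))"
      using that by (simp add: act_scale_right V.scale_right_diff_distrib mult.commute)
    then have "scale (a - 1) z - (X 0 2 (X 1 2 v) - X 1 2 ?p)
        = scale (2 * a) ?p - scale 2 (scale (a - 1) (X 3 1 v) - X 1 2 v)"
      using that by (simp add: X01 act_add_right act_diff_right act_scale_right z_def
          V.scale_right_diff_distrib algebra_simps)
    moreover have "X 0 2 (X 1 2 v) - X 1 2 ?p = scale 2 (X 1 2 v) - scale 2 ?p"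
      using that X_bracket[of 0 2 1 v] by (simp add: X_skew[of _ 2 1] act_neg_right algebra_simps)
    ultimately have "scale (a - 1) z = scale (2 * a) ?p - scale 2 (scale (a - 1) (X 3 1 v) - X 1 2 v)
        + (scale 2 (X 1 2 v) - scale 2 ?p)"
      by (simp add: diff_eq_eq)
    also have "\<dots> = scale (2 * a - 2) ?p + scale 4 (X 1 2 v) - scale (2 * (a - 1)) (X 3 1 v)"
      using V.scale_left_distrib[of 2 2 "X 1 2 v"]
      by (simp add: V.scale_right_diff_distrib V.scale_left_diff_distrib)
    finally have 2: "scale (a - 1) z = \<dots>" .
    have "scale 4 (scale (a - 1) ?p) = scale (2 * a - 2) ?p - scale (2 - 2 * a) ?p"
    proof -
      have "4 * (a - 1) = 2 * a - 2 - (2 - 2 * a)" by simp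
      then show ?thesis by (metis V.scale_left_diff_distrib V.scale_scale)
    qed
    also have "\<dots> = scale 4 (- scale a (X 2 3 v) - X 1 2 v)"
    proof -
      have "P - R = - T - Q" if "P + Q - u = R - T - u" for P Q R T u :: 'v
        using that by (simp add: algebra_simps)
      from this[OF 1[unfolded 2]] show ?thesis by (simp add: V.scale_right_diff_distrib mult.commute)
    qed
    finally have "scale 4 (scale (a - 1) ?p) = \<dots>" .
    then show ?thesis by (simp only: V.scale_cancel_left) simp
  qed
  \<comment> \<open>For \<open>a = 1\<close>, \<open>X02\<close> gives
    \<open>x_12 + x_23 = 0\<close>; applied to \<open>w 0\<close> this forces
    \<open>w 1 = - w 0\<close>, although their weights \<open>d - 2\<close> and \<open>d\<close>
    differ.\<close>
  have "a \<noteq> 1"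
  proof
    assume "a = 1"
    then have "X 1 2 (w 0) + X 2 3 (w 0) = 0" using X02[of "w 0"] by (simp add: algebra_simps)
    moreover have "X 3 1 (w 0) = scale (of_nat d) (w 0)" using X_w[of 0] by simp
    ultimately have "scale 2 (act (raise 2) (w 0)) - scale 2 (scale (of_nat d) (w 0))
        - scale 2 (act (lower 2) (w 0)) = 0"
      using w_V[of 0] by (simp only: X_1_raise X_3_lower) (simp add: scale_2_4 algebra_simps del: V.scale_scale)
    then have "scale 2 (- scale (of_nat d) (w 0) - scale (of_nat d) (w 1)) = scale 2 0"
      using raise_w0[of 2] lower_w[of 0] by (simp add: V.scale_right_diff_distrib del: w.simps)
    then have "- scale (of_nat d) (w 0) = scale (of_nat d) (w 1)"
      by (simp only: V.scale_cancel_left) simp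
    then have "scale (of_nat d) (- w 0) = scale (of_nat d) (w 1)" by simp
    then have w1: "w 1 = - w 0" using d_pos by (simp only: V.scale_cancel_left) auto
    have "X 3 1 (w 1) = scale (of_nat d) (w 1)"
      unfolding w1 using X_w[of 0] by (simp add: act_neg_right)
    then have "scale (of_nat d - 2) (w 1) = scale (of_nat d) (w 1)"
      using X_w[of 1] by (simp del: w.simps One_nat_def)
    then show False using w_neq_0[OF d_pos] by (simp only: V.scale_cancel_right) simp
  qed
  show ?thesis
  proof
    fix v assume v: "v \<in> V"
    have "scale a (X 0 1 v) = scale a (scale (1 - inverse a) (X 3 1 v) - scale (inverse a) (X 1 2 v))"
      using X01[OF v] \<open>a \<noteq> 0\<close> by (simp add: V.scale_right_diff_distrib right_diff_distrib)
    then show "X 0 1 v = scale (1 - inverse a) (X 3 1 v) - scale (inverse a) (X 1 2 v)"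
      using \<open>a \<noteq> 0\<close> by simp
    have "scale (a - 1) (X 0 2 v)
        = scale (a - 1) (scale (inverse (1 - a)) (X 1 2 v) + scale (a * inverse (1 - a)) (X 2 3 v))"
    proof -
      have "(a - 1) * inverse (1 - a) = - 1" "(a - 1) * (a * inverse (1 - a)) = - a"
        using \<open>a \<noteq> 1\<close> by (simp_all add: field_simps)
      then show ?thesis
        using X02[OF v] by (simp only: V.scale_right_distrib V.scale_scale) simp
    qed
    then show "X 0 2 v = scale (inverse (1 - a)) (X 1 2 v) + scale (a * inverse (1 - a)) (X 2 3 v)"
      using \<open>a \<noteq> 1\<close> by simp
  qed (use \<open>a \<noteq> 0\<close> \<open>a \<noteq> 1\<close> X03 in auto)
qed

section \<open>The isomorphism with an evaluation module\<close>

lemma iso_evaluation_module: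
  "\<exists>a. a \<noteq> 0 \<and> a \<noteq> 1 \<and> module_iso scale V act smult (Vd d) (evaluation_act d a)"
proof -
  obtain a where a: "a \<noteq> 0" "a \<noteq> 1"
    and X_0: "\<And>v. v \<in> V \<Longrightarrow> X 0 3 v = scale a (X 2 3 v) + scale (a - 1) (X 3 1 v)"
    "\<And>v. v \<in> V \<Longrightarrow> X 0 1 v = scale (1 - inverse a) (X 3 1 v) - scale (inverse a) (X 1 2 v)"
    "\<And>v. v \<in> V \<Longrightarrow> X 0 2 v = scale (inverse (1 - a)) (X 1 2 v) + scale (a * inverse (1 - a)) (X 2 3 v)"
    using X_0 by (metis (no_types, lifting))
  define S where "S p = (\<Sum>n\<le>d. scale (coeff p n) (w n))" for p
  \<comment> \<open>A linear lift of \<open>sl2\<close> sending \<open>e\<close>, \<open>f\<close>,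
    \<open>h\<close> to \<open>raise 2\<close>, \<open>lower 2\<close>, \<open>x_31\<close>. Through
    it the \<open>sl2\<close>-action on \<open>V\<close> can be compared with
    \<open>EV a\<close>.\<close>
  define \<phi> where "\<phi> A = tscale (sl2_entry A 1 2) (raise 2) + tscale (sl2_entry A 2 1) (lower 2)
    + tscale (sl2_entry A 1 1) (tgen 3 1)" for A
  have S_V: "S p \<in> V" for p unfolding S_def by (rule V.subspace_sum[OF subspace]) simp
  have S_add: "S (p + q) = S p + S q" for p q
    by (simp add: S_def V.scale_left_distrib sum.distrib)
  have S_smult: "S (smult c p) = scale c (S p)" for c p
    by (simp add: S_def V.scale_sum_right)
  have S_0: "S 0 = 0" by (simp add: S_def)
  have S_diff: "S (p - q) = S p - S q" for p q
    by (simp add: S_def V.scale_left_diff_distrib sum_subtractf)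
  have S_sum: "S (\<Sum>i\<in>I. r i) = (\<Sum>i\<in>I. S (r i))" for I :: "nat set" and r
    by (induction I rule: infinite_finite_induct) (simp_all add: S_0 S_add)
  have S_monom: "S (monom 1 n) = w n" if "n \<le> d" for n
  proof -
    have "S (monom 1 n) = (\<Sum>m\<le>d. if m = n then w n else 0)"
      unfolding S_def by (intro sum.cong) auto
    then show ?thesis using that by simp
  qed
  have act_\<phi>: "act (\<phi> A) v = scale (sl2_entry A 1 2) (act (raise 2) v)
      + scale (sl2_entry A 2 1) (act (lower 2) v) + scale (sl2_entry A 1 1) (X 3 1 v)"
    if "v \<in> V" for v A
    using that by (simp add: \<phi>_def act_add_left act_scale_left)
  have act_sum: "act u (\<Sum>i\<in>I. r i) = (\<Sum>i\<in>I. act u (r i))" if "\<And>i. r i \<in> V" for u r and I :: "nat set"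
    using that by (induction I rule: infinite_finite_induct)
      (simp_all add: act_add_right V.subspace_sum[OF subspace])
  have S_act_monom: "S (Vd_act d A (monom 1 n)) = act (\<phi> A) (w n)" if n: "n \<le> d" for A n
  proof -
    have "Vd_act d A (monom 1 n) =
        smult (sl2_entry A 1 2) (smult (of_nat n) (monom 1 (n - 1)))
        + smult (sl2_entry A 2 1) (smult (of_nat d - of_nat n) (monom 1 (Suc n)))
        + smult (sl2_entry A 1 1) (smult (of_nat d - 2 * of_nat n) (monom 1 n))"
    proof (rule poly_eqI)
      fix k
      consider "k = n" | "k = Suc n" | "n = Suc k" | "k \<noteq> n" "k \<noteq> Suc n" "n \<noteq> Suc k" by blast
      then show "coeff (Vd_act d A (monom 1 n)) k =
          coeff (smult (sl2_entry A 1 2) (smult (of_nat n) (monom 1 (n - 1)))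
        + smult (sl2_entry A 2 1) (smult (of_nat d - of_nat n) (monom 1 (Suc n)))
        + smult (sl2_entry A 1 1) (smult (of_nat d - 2 * of_nat n) (monom 1 n))) k"
        by cases (cases n; cases k; simp add: coeff_Vd_act coeff_pCons coeff_1 split: nat.split)+
    qed
    \<comment> \<open>At the top degree the monomial of degree \<open>d + 1\<close> leaves
      \<open>Vd d\<close>, but its coefficient is 0.\<close>
    moreover have "smult (of_nat d - of_nat n) (monom 1 (Suc n)) = (0 :: 'a poly)" if "n = d"
      using that by simp
    moreover have "S (monom 1 (Suc n)) = w (Suc n)" if "n \<noteq> d"
      using that n by (intro S_monom) simp
    ultimately show ?thesis
      using n by (cases "n = d")
        (simp_all del: w.simps add: S_add S_diff S_smult S_monom S_0 act_\<phi> raise_w lower_w X_w)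
  qed
  have S_act: "S (Vd_act d A p) = act (\<phi> A) (S p)" if "p \<in> Vd d" for A p
  proof -
    have "Vd_act d A p = (\<Sum>i\<le>d. smult (coeff p i) (Vd_act d A (monom 1 i)))"
      by (subst poly_as_sum_Vd[OF that]) (simp only: Vd_act_sum Vd_act_smult)
    then have "S (Vd_act d A p) = (\<Sum>i\<le>d. scale (coeff p i) (act (\<phi> A) (w i)))"
      by (simp add: S_sum S_smult S_act_monom)
    also have "\<dots> = act (\<phi> A) (S p)"
      unfolding S_def by (subst act_sum) (simp_all add: act_scale_right)
    finally show ?thesis .
  qed
  have \<phi>_gen: "act (\<phi> (EV a (tgen i j))) v = X i j v" if v: "v \<in> V" for i j v
  proof -
    have four: "(4 :: 4) = 0" by simp
    have skew: "act (\<phi> (EV a (tgen j i))) v = - act (\<phi> (EV a (tgen i j))) v" for i j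
      using tgen_skew[of i j, where 'a='a] v
      by (simp add: act_\<phi> EV_hom[OF a] sl2_entry_simps)
    have diag: "act (\<phi> (EV a (tgen i i))) v = X i i v" for i
      using v by (simp add: act_\<phi> tgen_relations(1) EV_hom[OF a] sl2_entry_simps)
    have entries: "sl2_entry sl2_x 1 1 = (- 1 :: 'a)" "sl2_entry sl2_x 1 2 = (2 :: 'a)"
      "sl2_entry sl2_x 2 1 = (0 :: 'a)"
      "sl2_entry sl2_y 1 1 = (- 1 :: 'a)" "sl2_entry sl2_y 1 2 = (0 :: 'a)" "sl2_entry sl2_y 2 1 = (- 2 :: 'a)"
      "sl2_entry sl2_z 1 1 = (1 :: 'a)" "sl2_entry sl2_z 1 2 = (0 :: 'a)" "sl2_entry sl2_z 2 1 = (0 :: 'a)"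
      by (simp_all add: sl2_x_def sl2_y_def sl2_z_def sl2_entry_simps)
    have gen: "act (\<phi> sl2_x) v = X 1 2 v" "act (\<phi> sl2_y) v = X 2 3 v" "act (\<phi> sl2_z) v = X 3 1 v"
      using v by (simp_all add: act_\<phi> entries X_1_raise X_3_lower)
    have \<phi>_lin: "act (\<phi> (A + B)) v = act (\<phi> A) v + act (\<phi> B) v"
      "act (\<phi> (A - B)) v = act (\<phi> A) v - act (\<phi> B) v"
      "act (\<phi> (sl2_scale c A)) v = scale c (act (\<phi> A) v)" for A B c
      using v by (simp_all add: act_\<phi> sl2_entry_simps V.scale_left_distrib V.scale_left_diff_distrib
          V.scale_right_distrib)
    have "act (\<phi> (EV a (tgen 1 2))) v = X 1 2 v" "act (\<phi> (EV a (tgen 2 3))) v = X 2 3 v"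
      "act (\<phi> (EV a (tgen 3 1))) v = X 3 1 v" "act (\<phi> (EV a (tgen 0 3))) v = X 0 3 v"
      "act (\<phi> (EV a (tgen 0 1))) v = X 0 1 v" "act (\<phi> (EV a (tgen 0 2))) v = X 0 2 v"
      using v by (simp_all add: EV_gen[OF a] \<phi>_lin gen X_0)
    moreover from this have "act (\<phi> (EV a (tgen 2 1))) v = X 2 1 v" "act (\<phi> (EV a (tgen 3 2))) v = X 3 2 v"
      "act (\<phi> (EV a (tgen 1 3))) v = X 1 3 v" "act (\<phi> (EV a (tgen 3 0))) v = X 3 0 v"
      "act (\<phi> (EV a (tgen 1 0))) v = X 1 0 v" "act (\<phi> (EV a (tgen 2 0))) v = X 2 0 v"
      by (metis skew X_skew[OF v])+
    ultimately show ?thesis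
      using exhaust_4[of i] exhaust_4[of j] unfolding four by (elim disjE) (simp_all add: diag)
  qed
  have S_hom: "S (evaluation_act d a u p) = act u (S p)" if "p \<in> Vd d" for u p
  proof -
    interpret M: lie_module sl2_scale sl2_bracket smult "Vd d" "Vd_act d :: 'a sl2 \<Rightarrow> _"
      by (rule lie_module_Vd)
    \<comment> \<open>Generators are settled by \<open>\<phi>_gen\<close>; brackets follow because
      both sides are Lie actions and \<open>EV a\<close> is a homomorphism.\<close>
    have "\<forall>p\<in>Vd d. S (Vd_act d (EV a u) p) = act u (S p)"
    proof (induction u rule: tetra_induct)
      case (gen i j)
      show ?case using S_act \<phi>_gen S_V by simp
    next
      case zero
      show ?case using S_V M.act_scale_left[of _ 0 0]
        by (simp add: EV_hom[OF a] Vd_act_def sl2_entry_simps S_0)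
    next
      case (bracket u v)
      then show ?case using S_V
        by (simp add: EV_hom[OF a] M.act_bracket S_diff M.act_closed act_bracket)
    qed (use S_V in \<open>simp_all add: EV_hom[OF a] M.act_add_left M.act_scale_left S_add S_smult
        act_add_left act_scale_left\<close>)
    then show ?thesis using that by (simp add: evaluation_act_def)
  qed
  have inj: "inj_on S (Vd d)"
  proof (rule inj_onI)
    fix p q :: "'a poly"
    assume pq: "p \<in> Vd d" "q \<in> Vd d" "S p = S q"
    then have 0: "(\<Sum>n\<le>d. scale (coeff (p - q) n) (w n)) = 0"
      using S_diff[of p q] by (simp add: S_def)
    \<comment> \<open>The summands are eigenvectors of \<open>x_31\<close> with distinct
      eigenvalues, or zero.\<close>
    have "scale (coeff (p - q) n) (w n) = 0" if "n \<le> d" for n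
      by (rule V.sum_eigenvectors_eq_0[OF _ subspace _ _ _ _ _ 0, of "X 3 1" "\<lambda>n. of_nat d - 2 * of_nat n"])
        (use that in \<open>auto simp: act_add_right act_scale_right X_w inj_on_def mult.commute\<close>)
    then have "coeff p n = coeff q n" if "n \<le> d" for n using w_neq_0 that by force
    then show "p = q" using poly_as_sum_Vd[OF pq(1)] poly_as_sum_Vd[OF pq(2)] by simp
  qed
  have "S ` Vd d = V"
  proof
    have "V.subspace (S ` Vd d)"
    proof (rule V.subspaceI)
      show "0 \<in> S ` Vd d" using S_0 by (auto simp: Vd_def intro!: image_eqI[of _ _ 0])
    next
      fix x y assume "x \<in> S ` Vd d" "y \<in> S ` Vd d"
      then obtain p q where "x = S p" "y = S q" "p + q \<in> Vd d"
        by (auto simp: Vd_def degree_add_le)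
      then show "x + y \<in> S ` Vd d" by (metis S_add imageI)
    next
      fix c x assume "x \<in> S ` Vd d"
      then obtain p where "x = S p" "smult c p \<in> Vd d" by (auto simp: Vd_def)
      then show "scale c x \<in> S ` Vd d" by (metis S_smult imageI)
    qed
    moreover have "w ` {..d} \<subseteq> S ` Vd d"
      using S_monom by (force simp: Vd_def degree_monom_eq image_iff intro: exI[of _ "monom 1 _"])
    ultimately show "V \<subseteq> S ` Vd d" using V.span_minimal span_w by metis
  qed (use S_V in auto)
  with inj have bij: "bij_betw S (Vd d) V" by (simp add: bij_betw_def)
  \<comment> \<open>The required isomorphism starts from \<open>V\<close>, hence the inverse of
    \<open>S\<close>.\<close>
  let ?T = "inv_into (Vd d) S"
  have T: "?T v \<in> Vd d" "S (?T v) = v" if "v \<in> V" for v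
    using bij that by (auto simp: bij_betw_def inv_into_into f_inv_into_f)
  have T_eq: "?T v = p" if "S p = v" "p \<in> Vd d" for v p
    using inj that by (auto simp: inv_into_f_f)
  have "module_iso scale V act smult (Vd d) (evaluation_act d a)"
    unfolding module_iso_def
  proof (intro exI[of _ ?T] conjI ballI allI)
    show "bij_betw ?T V (Vd d)" using bij by (rule bij_betw_inv_into)
  next
    fix u v assume "u \<in> V" "v \<in> V"
    then show "?T (u + v) = ?T u + ?T v"
      using T by (intro T_eq) (simp_all add: S_add, simp add: Vd_def degree_add_le)
  next
    fix c v assume "v \<in> V"
    then show "?T (scale c v) = smult c (?T v)"
      using T by (intro T_eq) (simp_all add: S_smult, simp add: Vd_def)
  next
    fix u v assume "v \<in> V"
    then show "?T (act u v) = evaluation_act d a u (?T v)"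
      using T by (intro T_eq) (simp_all add: S_hom, simp add: evaluation_act_def Vd_act_closed)
  qed
  then show ?thesis using a by blast
qed

end

theorem proposition6p4:
  fixes scale :: "'a::{alg_closed_field, field_char_0} \<Rightarrow> 'v::ab_group_add \<Rightarrow> 'v"
    and V :: "'v set"
    and act :: "'a tetra \<Rightarrow> 'v \<Rightarrow> 'v"
  assumes "tetra_module scale V act"
    and "finite_dim scale V"
    and "irreducible_action scale V act"
    and "\<not> trivial_action scale V act"
  shows "(\<exists>d\<ge>1. \<exists>a. a \<noteq> 0 \<and> a \<noteq> 1 \<and>
            module_iso scale V act smult (Vd d) (evaluation_act d a))
         \<longleftrightarrow> (\<exists>d. has_shape scale V act (replicate (d + 1) 1))"
proof -
  interpret tetrahedron_module scale V act by (rule tetrahedron_module.intro) fact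
  show ?thesis
  proof
    assume "\<exists>d. has_shape scale V act (replicate (d + 1) 1)"
    then obtain d where diam: "has_diameter scale V act d"
      and dim: "\<And>i j n. i \<noteq> j \<Longrightarrow> n \<le> d \<Longrightarrow> V.dim (E i j (2 * of_nat n - of_nat d)) = 1"
      by (auto simp: has_shape_def simp del: replicate_Suc)
    \<comment> \<open>Evaluation modules have \<open>d \<ge> 1\<close>; the case
      \<open>d = 0\<close> is ruled out by nontriviality.\<close>
    have "d \<noteq> 0"
    proof
      assume "d = 0"
      then have "trivial_action scale V act"
        using diam dim[of 3 1 0] by (intro trivial_if_diameter_0[OF assms(3)]) simp_all
      with assms(4) show False ..
    qed
    interpret thin_tetrahedron_module scale V act d
      by unfold_locales (use assms(3) diam dim \<open>d \<noteq> 0\<close> in simp_all)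
    show "\<exists>d\<ge>1. \<exists>a. a \<noteq> 0 \<and> a \<noteq> 1 \<and> module_iso scale V act smult (Vd d) (evaluation_act d a)"
      using iso_evaluation_module d_pos by blast
  qed (use has_shape_evaluation_module[OF assms(1)] in blast)
qed

end
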